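(* Let $k$ be an arbitrary field, $n\ge1$, and $A=A_n(k)$. Let $f:A\to A$ be a $k$-algebra endomorphism, with $A$ regarded as the subalgebra of $A_{2n}(k)$ generated by $x_1,\dots,x_n,\partial_1,\dots,\partial_n$. Define the left ideal $$J=(x_{n+1}-f(x_1),\dots,x_{2n}-f(x_n),\ \partial_{n+1}+f(\partial_1),\dots,\partial_{2n}+f(\partial_n))$$ of $A_{2n}(k)$. Let $A'$ be the subalgebra of $A_{2n}(k)$ generated by $x_{n+1},\dots,x_{2n},\partial_{n+1},\dots,\partial_{2n}$, and let $\tau:A'\to A'$ be the antihomomorphism of $k$-algebras with $\tau(x_{n+i})=x_{n+i}$ and $\tau(\partial_{n+i})=-\partial_{n+i}$ for $i=1,\dots,n$. When $f$ is invertible, regard $f^{-1}$ as an endomorphism of $A'$ via the isomorphism $A\cong A'$, $x_i\mapsto x_{n+i}$, $\partial_i\mapsto\partial_{n+i}$. (i) If $f$ is invertible, then $$J=(x_1-\tau f^{-1}(x_{n+1}),\dots,x_n-\tau f^{-1}(x_{2n}),\ \partial_1-\tau f^{-1}(\partial_{n+1}),\dots,\partial_n-\tau f^{-1}(\partial_{2n})).$$ (ii) If $J=(x_1-q_1,\dots,x_n-q_n,\ \partial_1-p_1,\dots,\partial_n-p_n)$ with $p_1,\dots,p_n,q_1,\dots,q_n\in A'$, then $f$ is invertible with $f^{-1}(x_{n+i})=\tau q_i$ and $f^{-1}(\partial_{n+i})=\tau p_i$ for $i=1,\dots,n$. (iii) Let $\prec$ denote the lexicographic term order on monomials in $A_{2n}(k)$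 given by $$x_1\succ\cdots\succ x_n\succ\partial_1\succ\cdots\succ\partial_n\succ x_{n+1}\succ\cdots\succ x_{2n}\succ\partial_{n+1}\succ\cdots\succ\partial_{2n}.$$ Then $f$ is invertible if and only if the reduced Gröbner basis of $J$ with respect to $\prec$ has the form $$\{x_1-q_1,\dots,x_n-q_n,\ \partial_1+p_1,\dots,\partial_n+p_n\}$$ with $p_1,\dots,p_n,q_1,\dots,q_n\in A'$.
   Context: For a field $k$ and $m\ge1$, the Weyl algebra $A_m(k)$ is the $k$-algebra generated by $x_1,\dots,x_m,\partial_1,\dots,\partial_m$ with relations $[x_i,x_j]=0$, $[\partial_i,\partial_j]=0$, $[\partial_i,x_j]=\delta_{ij}$. The monomials $x^\alpha\partial^\beta$, $\alpha,\beta\in\mathbb{N}^m$, form a $k$-basis. Parentheses $(g_1,\dots,g_r)$ denote the left ideal generated by $g_1,\dots,g_r$. A term order $\prec$ is a total order on these monomials with $1\preceq x^\alpha\partial^\beta$ for all $\alpha,\beta$, and with $x^\alpha\partial^\beta\prec x^{\alpha'}\partial^{\beta'}$ implying $x^{\alpha+\gamma}\partial^{\beta+\delta}\prec x^{\alpha'+\gamma}\partial^{\beta'+\delta}$. For non-zero $g=\sum\lambda_{\alpha,\beta}x^\alpha\partial^\beta$, $\mathrm{supp}(g)$ is the set of monomials with non-zero coefficient, the leading monomial $\mathrm{lm}(g)$ is the $\prec$-maximal element of $\mathrm{supp}(g)$, and the leading coefficient $\mathrm{lc}(g)$ is its coefficient. Write $x^\alpha\partial^\beta\le x^{\alpha'}\partial^{\beta'}$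 if $\alpha_i\le\alpha_i'$ and $\beta_i\le\beta'_i$ for all $i$. A non-zero $g$ is reducible by a finite set $S$ if there exist $m\in\mathrm{supp}(g)$ and $s\in S\setminus\{0\}$ with $\mathrm{lm}(s)\le m$. A finite subset $G$ is a Gröbner basis if for every non-zero $g$ in the left ideal generated by $G$ there is $d\in G$ with $\mathrm{lm}(d)\le\mathrm{lm}(g)$; it is a Gröbner basis of the left ideal $I$ if moreover $G$ generates $I$. A Gröbner basis $G=\{g_1,\dots,g_r\}$ is reduced if each $g_i\ne0$, $\mathrm{lc}(g_i)=1$, and $g_i$ is not reducible by $G\setminus\{g_i\}$. Every non-zero left ideal has a unique reduced Gröbner basis with respect to a given term order. *)

theory Defs
  imports Complex_Main "HOL-Library.FuncSet" "HOL-Library.Poly_Mapping"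
begin

section \<open>Ideals and subalgebras as hulls\<close>

definition left_ideal :: "'r::ring set \<Rightarrow> bool" where
  "left_ideal I \<longleftrightarrow> 0 \<in> I \<and> (\<forall>a\<in>I. \<forall>b\<in>I. a + b \<in> I) \<and> (\<forall>r. \<forall>a\<in>I. r * a \<in> I)"

definition two_sided_ideal :: "'r::ring set \<Rightarrow> bool" where
  "two_sided_ideal I \<longleftrightarrow> left_ideal I \<and> (\<forall>r. \<forall>a\<in>I. a * r \<in> I)"


section \<open>The free algebra\<close>

datatype 'g free_monoid = Word (letters: "'g list")

text \<open>
  The free monoid on the letters \<^typ>\<open>'g\<close>, written additively, because the multiplication of
  \<^typ>\<open>'a \<Rightarrow>\<^sub>0 'k\<close> is convolution with respect to the addition of \<^typ>\<open>'a\<close>.  Hence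
  \<^typ>\<open>'g free_monoid \<Rightarrow>\<^sub>0 'k\<close> is the free associative algebra on \<^typ>\<open>'g\<close>.
\<close>

instantiation free_monoid :: (type) monoid_add
begin

definition zero_free_monoid :: "'a free_monoid" where
  "0 = Word []"

definition plus_free_monoid :: "'a free_monoid \<Rightarrow> 'a free_monoid \<Rightarrow> 'a free_monoid" where
  "u + v = Word (letters u @ letters v)"

instance
  by standard (simp_all add: zero_free_monoid_def plus_free_monoid_def)

end


section \<open>The Weyl algebra\<close>

text \<open>
  The type \<^typ>\<open>'n\<close> is the index set of the variables; for a type with $m$ elements the algebra
  below is $A_m(k)$.
\<close>

datatype 'n gen = GX 'n | GD 'n

type_synonym ('k, 'n) free_alg = "'n gen free_monoid \<Rightarrow>\<^sub>0 'k"

definition fgen :: "'n gen \<Rightarrow> ('k::field, 'n) free_alg" where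
  "fgen g = Poly_Mapping.single (Word [g]) 1"

definition commutator :: "'r::ring \<Rightarrow> 'r \<Rightarrow> 'r" where
  "commutator a b = a * b - b * a"

definition weyl_relators :: "('k::field, 'n) free_alg set" where
  "weyl_relators =
     {commutator (fgen (GX i)) (fgen (GX j)) | i j. True} \<union>
     {commutator (fgen (GD i)) (fgen (GD j)) | i j. True} \<union>
     {commutator (fgen (GD i)) (fgen (GX j)) - (if i = j then 1 else 0) | i j. True}"

definition weyl_ideal :: "('k::field, 'n) free_alg set" where
  "weyl_ideal = two_sided_ideal hull weyl_relators"

lemma two_sided_ideal_weyl_ideal: "two_sided_ideal weyl_ideal"
  unfolding weyl_ideal_def
  by (rule hull_in) (auto simp: two_sided_ideal_def left_ideal_def)

lemma weyl_ideal_zero: "0 \<in> weyl_ideal"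
  and weyl_ideal_add: "a \<in> weyl_ideal \<Longrightarrow> b \<in> weyl_ideal \<Longrightarrow> a + b \<in> weyl_ideal"
  and weyl_ideal_mult_left: "a \<in> weyl_ideal \<Longrightarrow> r * a \<in> weyl_ideal"
  and weyl_ideal_mult_right: "a \<in> weyl_ideal \<Longrightarrow> a * r \<in> weyl_ideal"
  using two_sided_ideal_weyl_ideal by (auto simp: two_sided_ideal_def left_ideal_def)

lemma weyl_ideal_minus: "a \<in> weyl_ideal \<Longrightarrow> - a \<in> weyl_ideal"
  using weyl_ideal_mult_left[of a "- 1"] by simp

lemma weyl_ideal_diff: "a \<in> weyl_ideal \<Longrightarrow> b \<in> weyl_ideal \<Longrightarrow> a - b \<in> weyl_ideal"
  using weyl_ideal_add[of a "- b"] weyl_ideal_minus[of b] by simp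

quotient_type (overloaded) ('k, 'n) weyl =
  "('k::field, 'n) free_alg" / "\<lambda>p q. p - q \<in> weyl_ideal"
proof (intro equivpI reflpI sympI transpI)
  show "p - p \<in> weyl_ideal" for p :: "('k, 'n) free_alg"
    by (simp add: weyl_ideal_zero)
  show "q - p \<in> weyl_ideal" if "p - q \<in> weyl_ideal" for p q :: "('k, 'n) free_alg"
    using weyl_ideal_minus[OF that] by simp
  show "p - r \<in> weyl_ideal" if "p - q \<in> weyl_ideal" "q - r \<in> weyl_ideal"
    for p q r :: "('k, 'n) free_alg"
    using weyl_ideal_add[OF that] by simp
qed

text \<open>
  The class \<^class>\<open>ring_1\<close> includes $0 \neq 1$, so we need that the quotient does not collapse.
  For this we let the free algebra act on formal power series in the variables $x_i$ (given by
  their coefficient functions), with $\partial_i$ acting by differentiation.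
\<close>

fun act_gen :: "'n gen \<Rightarrow> (('n \<Rightarrow> nat) \<Rightarrow> 'k::field) \<Rightarrow> ('n \<Rightarrow> nat) \<Rightarrow> 'k" where
  "act_gen (GX i) F = (\<lambda>\<alpha>. if \<alpha> i = 0 then 0 else F (\<alpha>(i := \<alpha> i - 1)))"
| "act_gen (GD i) F = (\<lambda>\<alpha>. of_nat (Suc (\<alpha> i)) * F (\<alpha>(i := Suc (\<alpha> i))))"

definition act :: "('k::field, 'n) free_alg \<Rightarrow> (('n \<Rightarrow> nat) \<Rightarrow> 'k) \<Rightarrow> ('n \<Rightarrow> nat) \<Rightarrow> 'k" where
  "act p F = (\<lambda>\<alpha>. \<Sum>w\<in>Poly_Mapping.keys p. Poly_Mapping.lookup p w * foldr act_gen (letters w) F \<alpha>)"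

lemma act_superset:
  assumes "finite S" "Poly_Mapping.keys p \<subseteq> S"
  shows "act p F \<alpha> = (\<Sum>w\<in>S. Poly_Mapping.lookup p w * foldr act_gen (letters w) F \<alpha>)"
  unfolding act_def using assms
  by (intro sum.mono_neutral_left) (auto simp: in_keys_iff)

lemma act_add: "act (p + q) F \<alpha> = act p F \<alpha> + act q F \<alpha>"
proof -
  let ?S = "Poly_Mapping.keys p \<union> Poly_Mapping.keys q"
  have "Poly_Mapping.keys (p + q) \<subseteq> ?S" by (rule Poly_Mapping.keys_add)
  then show ?thesis
    by (simp add: act_superset[of ?S] lookup_add distrib_right sum.distrib)
qed

lemma act_zero [simp]: "act 0 F = (\<lambda>_. 0)"
  by (simp add: act_def)

lemma act_single: "act (Poly_Mapping.single w c) F \<alpha> = c * foldr act_gen (letters w) F \<alpha>"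
  by (subst act_superset[of "{w}"]) (simp_all)

lemma act_gen_lin: "act_gen g (\<lambda>\<alpha>. c * F \<alpha> + d * G \<alpha>) = (\<lambda>\<alpha>. c * act_gen g F \<alpha> + d * act_gen g G \<alpha>)"
  by (cases g) (auto simp: fun_eq_iff algebra_simps)

lemma act_word_lin:
  "foldr act_gen w (\<lambda>\<alpha>. c * F \<alpha> + d * G \<alpha>) =
     (\<lambda>\<alpha>. c * foldr act_gen w F \<alpha> + d * foldr act_gen w G \<alpha>)"
  by (induction w) (simp_all add: act_gen_lin)

lemma act_lin:
  "act p (\<lambda>\<alpha>. c * F \<alpha> + d * G \<alpha>) = (\<lambda>\<alpha>. c * act p F \<alpha> + d * act p G \<alpha>)"
  by (simp add: act_def act_word_lin fun_eq_iff sum_distrib_left sum.distrib distrib_left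
      mult.left_commute)

lemma free_alg_induct [case_names zero single add]:
  fixes p :: "'a \<Rightarrow>\<^sub>0 'b::comm_monoid_add"
  assumes "P 0" "\<And>w c. P (Poly_Mapping.single w c)" "\<And>p q. P p \<Longrightarrow> P q \<Longrightarrow> P (p + q)"
  shows "P p"
proof -
  have "P (\<Sum>w\<in>S. Poly_Mapping.single w (Poly_Mapping.lookup p w))" if "finite S" for S
    using that by (induction S) (auto intro: assms)
  moreover have "(\<Sum>w\<in>Poly_Mapping.keys p. Poly_Mapping.single w (Poly_Mapping.lookup p w)) = p"
    by (rule poly_mapping_eqI)
      (auto simp: lookup_sum lookup_single when_def sum.delta in_keys_iff)
  ultimately show ?thesis by (metis finite_keys)
qed

lemma act_mult: "act (p * q) F \<alpha> = act p (act q F) \<alpha>"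
proof (induction p arbitrary: \<alpha> rule: free_alg_induct)
  case (single w c)
  show ?case
  proof (induction q arbitrary: \<alpha> rule: free_alg_induct)
    case zero
    show ?case using act_lin[of "Poly_Mapping.single w c" 0 F 0 F] by (simp add: fun_eq_iff)
  next
    case (single v d)
    have "act (Poly_Mapping.single v d) F = (\<lambda>\<alpha>. d * foldr act_gen (letters v) F \<alpha> + 0 * F \<alpha>)"
      by (simp add: fun_eq_iff act_single)
    then show ?case
      by (simp only: act_lin) (simp add: mult_single act_single plus_free_monoid_def)
  next
    case (add p q)
    have "act (p + q) F = (\<lambda>\<alpha>. 1 * act p F \<alpha> + 1 * act q F \<alpha>)"
      by (simp add: fun_eq_iff act_add)
    then show ?case
      by (simp only: act_lin distrib_left act_add add.IH) simp
  qed
qed (simp_all add: act_add distrib_right)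

lemma act_one [simp]: "act 1 F = F"
  by (simp add: fun_eq_iff act_single zero_free_monoid_def flip: single_one)

lemma act_diff: "act (p - q) F \<alpha> = act p F \<alpha> - act q F \<alpha>"
  using act_add[of "p - q" q F \<alpha>] by simp

lemma act_fgen: "act (fgen g) F = act_gen g F"
  by (simp add: fun_eq_iff fgen_def act_single)

lemma act_relators: "p \<in> weyl_relators \<Longrightarrow> act p F \<alpha> = 0"
  by (auto simp: weyl_relators_def commutator_def act_diff act_mult act_fgen fun_upd_twist
      distrib_right split: if_splits)
    (simp_all add: algebra_simps)

lemma act_weyl_ideal:
  fixes p :: "('a::field, 'b) free_alg"
  assumes "p \<in> weyl_ideal"
  shows "act p F \<alpha> = 0"
proof -
  have "two_sided_ideal {p :: ('a, 'b) free_alg. \<forall>F \<alpha>. act p F \<alpha> = 0}"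
    unfolding two_sided_ideal_def left_ideal_def
  proof (intro conjI allI ballI)
    fix r a :: "('a, 'b) free_alg"
    assume "a \<in> {p. \<forall>F \<alpha>. act p F \<alpha> = 0}"
    then have a: "act a F = (\<lambda>_. 0)" for F by (simp add: fun_eq_iff)
    have "act r (\<lambda>_. 0) = (\<lambda>_. 0)"
      using act_lin[of r 0 "\<lambda>_. 0" 0 "\<lambda>_. 0"] by simp
    then show "r * a \<in> {p. \<forall>F \<alpha>. act p F \<alpha> = 0}" "a * r \<in> {p. \<forall>F \<alpha>. act p F \<alpha> = 0}"
      by (simp_all add: act_mult a)
  qed (simp_all add: act_add)
  then have "weyl_ideal \<subseteq> {p :: ('a, 'b) free_alg. \<forall>F \<alpha>. act p F \<alpha> = 0}"
    unfolding weyl_ideal_def by (intro hull_minimal) (auto simp: act_relators)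
  then show ?thesis using assms by auto
qed

lemma one_notin_weyl_ideal: "1 \<notin> weyl_ideal"
  using act_weyl_ideal[of 1 "\<lambda>_. 1"] by auto

instantiation weyl :: (field, type) ring_1
begin

lift_definition zero_weyl :: "('a, 'b) weyl" is 0 .

lift_definition one_weyl :: "('a, 'b) weyl" is 1 .

lift_definition plus_weyl :: "('a, 'b) weyl \<Rightarrow> ('a, 'b) weyl \<Rightarrow> ('a, 'b) weyl" is "(+)"
  by (metis weyl_ideal_add add_diff_add)

lift_definition uminus_weyl :: "('a, 'b) weyl \<Rightarrow> ('a, 'b) weyl" is uminus
  by (metis weyl_ideal_minus minus_diff_minus)

lift_definition minus_weyl :: "('a, 'b) weyl \<Rightarrow> ('a, 'b) weyl \<Rightarrow> ('a, 'b) weyl" is "(-)"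
proof -
  fix a b c d :: "('a, 'b) free_alg"
  assume "a - b \<in> weyl_ideal" "c - d \<in> weyl_ideal"
  then have "(a - b) - (c - d) \<in> weyl_ideal" by (rule weyl_ideal_diff)
  then show "(a - c) - (b - d) \<in> weyl_ideal" by (simp add: algebra_simps)
qed

lift_definition times_weyl :: "('a, 'b) weyl \<Rightarrow> ('a, 'b) weyl \<Rightarrow> ('a, 'b) weyl" is "(*)"
proof -
  fix a b c d :: "('a, 'b) free_alg"
  assume "a - b \<in> weyl_ideal" "c - d \<in> weyl_ideal"
  then have "(a - b) * c + b * (c - d) \<in> weyl_ideal"
    by (intro weyl_ideal_add weyl_ideal_mult_left weyl_ideal_mult_right)
  then show "a * c - b * d \<in> weyl_ideal" by (simp add: algebra_simps)
qed

instance
proof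
  fix a b c :: "('a, 'b) weyl"
  show "a + b + c = a + (b + c)" "a + b = b + a" "0 + a = a" "- a + a = 0" "a - b = a + - b"
    by (transfer; simp add: weyl_ideal_zero add_ac)+
  show "a * b * c = a * (b * c)" "(a + b) * c = a * c + b * c" "a * (b + c) = a * b + a * c"
    "1 * a = a" "a * 1 = a"
    by (transfer; simp add: weyl_ideal_zero mult.assoc distrib_left distrib_right)+
  show "0 \<noteq> (1 :: ('a, 'b) weyl)"
    by transfer (use weyl_ideal_minus one_notin_weyl_ideal in fastforce)
qed

end

lift_definition wx :: "'n \<Rightarrow> ('k::field, 'n) weyl" is "\<lambda>i. fgen (GX i)" .

lift_definition wd :: "'n \<Rightarrow> ('k::field, 'n) weyl" is "\<lambda>i. fgen (GD i)" .

lift_definition wscale :: "'k::field \<Rightarrow> ('k, 'n) weyl \<Rightarrow> ('k, 'n) weyl" (infixr \<open>\<cdot>\<close> 75)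
  is "\<lambda>c p. Poly_Mapping.single 0 c * p"
  by (metis weyl_ideal_mult_left right_diff_distrib)

lemma weyl_commutators:
  "commutator (wx i) (wx j) = (0 :: ('k::field, 'n) weyl)"
  "commutator (wd i) (wd j) = (0 :: ('k, 'n) weyl)"
  "commutator (wd i) (wx j) = (if i = j then 1 else 0 :: ('k, 'n) weyl)"
proof -
  have rel: "weyl_relators \<subseteq> (weyl_ideal :: ('k, 'n) free_alg set)"
    unfolding weyl_ideal_def by (rule hull_subset)
  have xx: "commutator (fgen (GX i)) (fgen (GX j)) \<in> (weyl_ideal :: ('k, 'n) free_alg set)" for i j
    by (rule subsetD[OF rel], unfold weyl_relators_def, rule UnI1, rule UnI1, rule CollectI)
      (rule exI, rule exI, rule conjI, rule refl, rule TrueI)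
  have dd: "commutator (fgen (GD i)) (fgen (GD j)) \<in> (weyl_ideal :: ('k, 'n) free_alg set)" for i j
    by (rule subsetD[OF rel], unfold weyl_relators_def, rule UnI1, rule UnI2, rule CollectI)
      (rule exI, rule exI, rule conjI, rule refl, rule TrueI)
  have dx: "commutator (fgen (GD i)) (fgen (GX j)) - (if i = j then 1 else 0)
              \<in> (weyl_ideal :: ('k, 'n) free_alg set)" for i j
    by (rule subsetD[OF rel], unfold weyl_relators_def, rule UnI2, rule CollectI)
      (rule exI, rule exI, rule conjI, rule refl, rule TrueI)
  show "commutator (wx i) (wx j) = (0 :: ('k, 'n) weyl)"
    unfolding commutator_def
    by transfer (use xx in \<open>simp add: commutator_def\<close>)
  show "commutator (wd i) (wd j) = (0 :: ('k, 'n) weyl)"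
    unfolding commutator_def
    by transfer (use dd in \<open>simp add: commutator_def\<close>)
  have dx_same: "commutator (fgen (GD i)) (fgen (GX i)) - 1 \<in> (weyl_ideal :: ('k, 'n) free_alg set)" for i
    using dx[of i i] by simp
  have dx_diff: "commutator (fgen (GD i)) (fgen (GX j)) \<in> (weyl_ideal :: ('k, 'n) free_alg set)"
    if "i \<noteq> j" for i j
    using dx[of i j] that by simp
  have "commutator (wd i) (wx i) = (1 :: ('k, 'n) weyl)"
    unfolding commutator_def
    by transfer (use dx_same in \<open>simp add: commutator_def\<close>)
  moreover have "i \<noteq> j \<longrightarrow> commutator (wd i) (wx j) = (0 :: ('k, 'n) weyl)"
    unfolding commutator_def
    by transfer (use dx_diff in \<open>simp add: commutator_def\<close>)
  ultimately show "commutator (wd i) (wx j) = (if i = j then 1 else 0 :: ('k, 'n) weyl)"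
    by auto
qed

lemma vector_space_wscale: "vector_space (wscale :: 'k::field \<Rightarrow> ('k, 'n) weyl \<Rightarrow> ('k, 'n) weyl)"
proof
  fix a b :: 'k and v w :: "('k, 'n) weyl"
  show "a \<cdot> (v + w) = a \<cdot> v + a \<cdot> w"
    by transfer (simp add: distrib_left weyl_ideal_zero)
  show "(a + b) \<cdot> v = a \<cdot> v + b \<cdot> v"
    by transfer (simp add: single_add distrib_right weyl_ideal_zero)
  show "a \<cdot> b \<cdot> v = (a * b) \<cdot> v"
    by transfer (simp add: mult_single weyl_ideal_zero flip: mult.assoc)
  show "1 \<cdot> v = v"
    by transfer (simp add: weyl_ideal_zero)
qed


section \<open>Homomorphisms and subalgebras\<close>

definition subalgebra :: "('k::field, 'n) weyl set \<Rightarrow> bool" where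
  "subalgebra B \<longleftrightarrow> 1 \<in> B \<and> (\<forall>a\<in>B. \<forall>b\<in>B. a + b \<in> B \<and> a * b \<in> B) \<and> (\<forall>c. \<forall>a\<in>B. c \<cdot> a \<in> B)"

definition algebra_hom :: "(('k::field, 'n) weyl \<Rightarrow> ('k, 'm) weyl) \<Rightarrow> bool" where
  "algebra_hom f \<longleftrightarrow>
     f 1 = 1 \<and> (\<forall>a b. f (a + b) = f a + f b) \<and> (\<forall>a b. f (a * b) = f a * f b) \<and>
     (\<forall>c a. f (c \<cdot> a) = c \<cdot> f a)"

definition algebra_antihom_on ::
    "('k::field, 'n) weyl set \<Rightarrow> (('k, 'n) weyl \<Rightarrow> ('k, 'n) weyl) \<Rightarrow> bool" where
  "algebra_antihom_on B t \<longleftrightarrow>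
     t \<in> B \<rightarrow> B \<and> t 1 = 1 \<and> (\<forall>a\<in>B. \<forall>b\<in>B. t (a + b) = t a + t b) \<and>
     (\<forall>a\<in>B. \<forall>b\<in>B. t (a * b) = t b * t a) \<and> (\<forall>c. \<forall>a\<in>B. t (c \<cdot> a) = c \<cdot> t a)"

definition invertible_endo :: "(('k::field, 'n) weyl \<Rightarrow> ('k, 'n) weyl) \<Rightarrow> bool" where
  "invertible_endo f \<longleftrightarrow> algebra_hom f \<and> (\<exists>g. algebra_hom g \<and> g \<circ> f = id \<and> f \<circ> g = id)"

text \<open>
  With index type \<^typ>\<open>'n\<close> for $A = A_n(k)$, we index $A_{2n}(k)$ by \<^typ>\<open>'n + 'n\<close>: \<^term>\<open>Inl i\<close> is
  the index $i$ and \<^term>\<open>Inr i\<close> is the index $n + i$.  The embedding \<^term>\<open>embed h\<close> is the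
  algebra homomorphism with $x_i \mapsto x_{h(i)}$ and $\partial_i \mapsto \partial_{h(i)}$; it exists
  for injective \<^term>\<open>h\<close>.
\<close>

definition embed :: "('n \<Rightarrow> 'm) \<Rightarrow> ('k::field, 'n) weyl \<Rightarrow> ('k, 'm) weyl" where
  "embed h = (THE \<phi>. algebra_hom \<phi> \<and> (\<forall>i. \<phi> (wx i) = wx (h i) \<and> \<phi> (wd i) = wd (h i)))"

definition second_copy :: "('k::field, 'n + 'n) weyl set" where
  "second_copy = subalgebra hull (range (\<lambda>i. wx (Inr i)) \<union> range (\<lambda>i. wd (Inr i)))"

definition on_second_copy ::
    "(('k::field, 'n) weyl \<Rightarrow> ('k, 'n) weyl) \<Rightarrow> ('k, 'n + 'n) weyl \<Rightarrow> ('k, 'n + 'n) weyl" where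
  "on_second_copy g = embed Inr \<circ> g \<circ> inv (embed Inr)"

definition endo_ideal :: "(('k::field, 'n) weyl \<Rightarrow> ('k, 'n) weyl) \<Rightarrow> ('k, 'n + 'n) weyl set" where
  "endo_ideal f = left_ideal hull
     (range (\<lambda>i. wx (Inr i) - embed Inl (f (wx i))) \<union>
      range (\<lambda>i. wd (Inr i) + embed Inl (f (wd i))))"


section \<open>Monomials and term orders\<close>

text \<open>
  The pair $(\alpha, \beta)$ of exponent vectors stands for the monomial $x^\alpha\partial^\beta$.
  The class \<^class>\<open>enum\<close> provides the enumeration $1, \dots, m$ of the index type, that is, a list
  of its elements without repetition.
\<close>

type_synonym 'n monomial = "('n \<Rightarrow> nat) \<times> ('n \<Rightarrow> nat)"

definition wmonom :: "'n::enum monomial \<Rightarrow> ('k::field, 'n) weyl" where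
  "wmonom m = prod_list (map (\<lambda>i. wx i ^ fst m i) enum_class.enum) *
              prod_list (map (\<lambda>i. wd i ^ snd m i) enum_class.enum)"

text \<open>The unique expansion with respect to the basis of monomials.\<close>

definition expansion :: "('k::field, 'n::enum) weyl \<Rightarrow> 'n monomial \<Rightarrow>\<^sub>0 'k" where
  "expansion g = (THE c. g = (\<Sum>m\<in>Poly_Mapping.keys c. Poly_Mapping.lookup c m \<cdot> wmonom m))"

definition supp :: "('k::field, 'n::enum) weyl \<Rightarrow> 'n monomial set" where
  "supp g = Poly_Mapping.keys (expansion g)"

definition monom_dvd :: "'n monomial \<Rightarrow> 'n monomial \<Rightarrow> bool" where
  "monom_dvd m m' \<longleftrightarrow> (\<forall>i. fst m i \<le> fst m' i \<and> snd m i \<le> snd m' i)"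

definition monom_plus :: "'n monomial \<Rightarrow> 'n monomial \<Rightarrow> 'n monomial" where
  "monom_plus m m' = (\<lambda>i. fst m i + fst m' i, \<lambda>i. snd m i + snd m' i)"

text \<open>Term orders are given by their strict part.\<close>

definition term_order :: "('n monomial \<Rightarrow> 'n monomial \<Rightarrow> bool) \<Rightarrow> bool" where
  "term_order lt \<longleftrightarrow>
     irreflp lt \<and> transp lt \<and> totalp lt \<and>
     (\<forall>m. m \<noteq> (\<lambda>_. 0, \<lambda>_. 0) \<longrightarrow> lt (\<lambda>_. 0, \<lambda>_. 0) m) \<and>
     (\<forall>m m' c. lt m m' \<longrightarrow> lt (monom_plus m c) (monom_plus m' c))"

text \<open>The following are meaningful for a term order \<^term>\<open>lt\<close> and non-zero \<^term>\<open>g\<close>.\<close>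

definition lm :: "('n monomial \<Rightarrow> 'n monomial \<Rightarrow> bool) \<Rightarrow> ('k::field, 'n::enum) weyl \<Rightarrow> 'n monomial" where
  "lm lt g = (THE m. m \<in> supp g \<and> (\<forall>m'\<in>supp g. m' \<noteq> m \<longrightarrow> lt m' m))"

definition lc :: "('n monomial \<Rightarrow> 'n monomial \<Rightarrow> bool) \<Rightarrow> ('k::field, 'n::enum) weyl \<Rightarrow> 'k" where
  "lc lt g = Poly_Mapping.lookup (expansion g) (lm lt g)"


section \<open>Groebner bases\<close>

text \<open>Only non-zero elements of a set can serve as divisors, since 0 has no leading monomial.\<close>

definition reducible ::
    "('n monomial \<Rightarrow> 'n monomial \<Rightarrow> bool) \<Rightarrow> ('k::field, 'n::enum) weyl \<Rightarrow> ('k, 'n) weyl set \<Rightarrow> bool" where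
  "reducible lt g S \<longleftrightarrow> (\<exists>m\<in>supp g. \<exists>s\<in>S - {0}. monom_dvd (lm lt s) m)"

definition groebner_basis ::
    "('n monomial \<Rightarrow> 'n monomial \<Rightarrow> bool) \<Rightarrow> ('k::field, 'n::enum) weyl set \<Rightarrow> bool" where
  "groebner_basis lt G \<longleftrightarrow>
     finite G \<and>
     (\<forall>g \<in> left_ideal hull G. g \<noteq> 0 \<longrightarrow> (\<exists>d \<in> G - {0}. monom_dvd (lm lt d) (lm lt g)))"

definition groebner_basis_of ::
    "('n monomial \<Rightarrow> 'n monomial \<Rightarrow> bool) \<Rightarrow> ('k::field, 'n::enum) weyl set \<Rightarrow> ('k, 'n) weyl set \<Rightarrow> bool" where
  "groebner_basis_of lt I G \<longleftrightarrow> groebner_basis lt G \<and> left_ideal hull G = I"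

definition reduced_groebner_basis_of ::
    "('n monomial \<Rightarrow> 'n monomial \<Rightarrow> bool) \<Rightarrow> ('k::field, 'n::enum) weyl set \<Rightarrow> ('k, 'n) weyl set \<Rightarrow> bool" where
  "reduced_groebner_basis_of lt I G \<longleftrightarrow>
     groebner_basis_of lt I G \<and>
     (\<forall>g\<in>G. g \<noteq> 0 \<and> lc lt g = 1 \<and> \<not> reducible lt g (G - {g}))"


section \<open>The lexicographic order\<close>

text \<open>
  The variables in decreasing order:
  $x_1, \dots, x_n, \partial_1, \dots, \partial_n, x_{n+1}, \dots, x_{2n}, \partial_{n+1}, \dots, \partial_{2n}$.
\<close>

definition exponent_list :: "('n::enum + 'n) monomial \<Rightarrow> nat list" where
  "exponent_list m =
     map (\<lambda>i. fst m (Inl i)) enum_class.enum @ map (\<lambda>i. snd m (Inl i)) enum_class.enum @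
     map (\<lambda>i. fst m (Inr i)) enum_class.enum @ map (\<lambda>i. snd m (Inr i)) enum_class.enum"

definition lex_less :: "('n::enum + 'n) monomial \<Rightarrow> ('n + 'n) monomial \<Rightarrow> bool" where
  "lex_less m m' \<longleftrightarrow> (exponent_list m, exponent_list m') \<in> lex {(a, b). a < b}"

lemma length_exponent_list [simp]:
  "length (exponent_list (m :: ('n::enum + 'n) monomial)) = 4 * length (enum_class.enum :: 'n list)"
  by (simp add: exponent_list_def)

lemma exponent_list_eq_iff: "exponent_list m = exponent_list m' \<longleftrightarrow> m = m'"
proof
  assume "exponent_list m = exponent_list m'"
  then have "fst m (Inl i) = fst m' (Inl i) \<and> snd m (Inl i) = snd m' (Inl i) \<and>
      fst m (Inr i) = fst m' (Inr i) \<and> snd m (Inr i) = snd m' (Inr i)" for i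
    using enum_UNIV by (auto simp: exponent_list_def)
  then have "fst m j = fst m' j \<and> snd m j = snd m' j" for j
    by (cases j) simp_all
  then show "m = m'" by (simp add: prod_eq_iff fun_eq_iff)
qed simp

lemma exponent_list_monom_plus:
  "exponent_list (monom_plus m c) = map2 (+) (exponent_list m) (exponent_list c)"
  by (simp add: exponent_list_def monom_plus_def zip_append zip_map1 zip_map2 zip_same_conv_map)

lemma lex_map2_add:
  "(xs, ys) \<in> lex {(a, b). a < b} \<Longrightarrow> length zs = length xs \<Longrightarrow>
     (map2 (+) xs zs, map2 (+) ys zs) \<in> lex {(a, b). a < (b :: nat)}"
proof (induction xs arbitrary: ys zs)
  case (Cons x xs)
  then show ?case by (cases ys; cases zs) (auto simp: Cons_in_lex)
qed simp

lemma lex_zero: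
  "length zs = n \<Longrightarrow> zs \<noteq> replicate n 0 \<Longrightarrow> (replicate n 0, zs) \<in> lex {(a, b). a < (b :: nat)}"
  by (induction zs arbitrary: n) (auto simp: Cons_in_lex)

lemma term_order_lex_less: "term_order (lex_less :: ('n::enum + 'n) monomial \<Rightarrow> _)"
  unfolding term_order_def
proof (intro conjI allI impI)
  let ?R = "{(a, b). a < (b :: nat)}"
  have irr: "(xs, xs) \<notin> lex ?R" for xs
    by (induction xs) auto
  show "irreflp (lex_less :: ('n + 'n) monomial \<Rightarrow> _)"
    by (auto simp: irreflp_def lex_less_def irr)
  have "trans ?R" by (auto simp: trans_def)
  then have "trans (lex ?R)" by (rule lex_transI)
  then show "transp (lex_less :: ('n + 'n) monomial \<Rightarrow> _)"
    unfolding transp_def lex_less_def by (blast dest: transD)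
  have tot: "(xs, ys) \<in> lex ?R \<or> (ys, xs) \<in> lex ?R" if "length xs = length ys" "xs \<noteq> ys" for xs ys
    using that by (induction xs ys rule: list_induct2) auto
  show "totalp (lex_less :: ('n + 'n) monomial \<Rightarrow> _)"
    unfolding totalp_on_def lex_less_def by (metis tot exponent_list_eq_iff length_exponent_list)
  show "lex_less (\<lambda>_. 0, \<lambda>_. 0) m" if "m \<noteq> (\<lambda>_. 0, \<lambda>_. 0)" for m :: "('n + 'n) monomial"
  proof -
    let ?z = "(\<lambda>_. 0, \<lambda>_. 0) :: ('n + 'n) monomial"
    have z: "exponent_list ?z = replicate (length (exponent_list m)) 0"
      by (intro replicate_eqI) (auto simp: exponent_list_def)
    moreover have "exponent_list m \<noteq> exponent_list ?z"
      using that by (simp only: exponent_list_eq_iff) simp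
    ultimately show ?thesis
      unfolding lex_less_def by (metis lex_zero)
  qed
  show "lex_less (monom_plus m c) (monom_plus m' c)" if "lex_less m m'"
    for m m' c :: "('n + 'n) monomial"
    using that unfolding lex_less_def exponent_list_monom_plus
    by (intro lex_map2_add) simp_all
qed

end

theory Submission
  imports Defs "HOL-Library.Function_Algebras"
begin

text \<open>
  Since the second copy \<open>A'\<close> of \<open>A\<close> is isomorphic to the opposite algebra of \<open>A\<close> via \<open>\<tau>\<close>, left
  modules over \<open>A\<^sub>2\<^sub>n\<close> are \<open>A\<close>-bimodules.  The ideal \<open>J\<close> is the annihilator of \<open>1\<close> in the bimodule
  \<open>A\<close> whose right action is twisted by \<open>f\<close>; that is, \<open>J\<close> is the kernel of a map
  \<open>\<epsilon> : A\<^sub>2\<^sub>n \<rightarrow> A\<close> with \<open>\<epsilon> a = a\<close> for \<open>a \<in> A\<close> and \<open>\<epsilon> b = f (\<tau> b)\<close> for \<open>b \<in> A'\<close>.  Hence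
  \<open>x\<^sub>i - q\<^sub>i \<in> J\<close> means \<open>f (\<tau> q\<^sub>i) = x\<^sub>i\<close>, and \<open>J \<inter> A'\<close> corresponds to the kernel of \<open>f\<close>.  Generators
  as in (ii) make \<open>f\<close> surjective, and surjective endomorphisms are injective because the two-sided
  ideals of \<open>A\<close> satisfy the ascending chain condition (in positive characteristic \<open>A\<close> is not
  simple).  In (iii), a non-zero element of \<open>J\<close> whose leading monomial is divisible by no \<open>x\<^sub>i\<close> or
  \<open>\<partial>\<^sub>i\<close> with \<open>i \<le> n\<close> would lie in \<open>J \<inter> A'\<close>, which is \<open>0\<close> for invertible \<open>f\<close>.
\<close>

section \<open>Calculations in the Weyl algebra\<close>

interpretation weyl_vs: vector_space "wscale :: 'k::field \<Rightarrow> ('k, 'n) weyl \<Rightarrow> ('k, 'n) weyl"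
  by (rule vector_space_wscale)

lemma single_zero_central:
  fixes p :: "('k::field, 'n) free_alg"
  shows "Poly_Mapping.single 0 c * p = p * Poly_Mapping.single 0 c"
  by (induction p rule: free_alg_induct) (simp_all add: mult_single algebra_simps)

lemma wscale_mult_left: "(c \<cdot> a) * b = c \<cdot> (a * b)"
  by transfer (simp add: mult.assoc weyl_ideal_zero)

lemma wscale_mult_right: "a * (c \<cdot> b) = c \<cdot> (a * b)"
proof transfer
  fix a b :: "('a, 'b) free_alg" and c
  have "a * (Poly_Mapping.single 0 c * b) = (a * Poly_Mapping.single 0 c) * b"
    by (simp add: mult.assoc)
  then show "a * (Poly_Mapping.single 0 c * b) - Poly_Mapping.single 0 c * (a * b) \<in> weyl_ideal"
    by (simp add: mult.assoc weyl_ideal_zero flip: single_zero_central)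
qed

lemma wx_wx: "wx i * wx j = wx j * wx i"
  and wd_wd: "wd i * wd j = wd j * wd i"
  and wd_wx: "wd i * wx j = wx j * wd i + (if i = j then 1 else 0)"
  using weyl_commutators[of i j] by (auto simp: commutator_def algebra_simps)

text \<open>Elements are classes of linear combinations of words, and a word arises from
  \<open>1\<close> by prepending letters. Thus properties of an action need checking only for left
  multiplication by generators.\<close>

lemma weyl_induct [case_names one add scale wx wd]:
  fixes a :: "('k::field, 'n) weyl"
  assumes one: "P 1"
    and add: "\<And>a b. P a \<Longrightarrow> P b \<Longrightarrow> P (a + b)"
    and scale: "\<And>c a. P a \<Longrightarrow> P (c \<cdot> a)"
    and wx: "\<And>i a. P a \<Longrightarrow> P (wx i * a)"
    and wd: "\<And>i a. P a \<Longrightarrow> P (wd i * a)"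
  shows "P a"
proof -
  define \<pi> :: "('k, 'n) free_alg \<Rightarrow> ('k, 'n) weyl" where "\<pi> = abs_weyl"
  have mult: "\<pi> (p * q) = \<pi> p * \<pi> q" for p q
    unfolding \<pi>_def by (simp add: times_weyl.abs_eq)
  have P0: "P 0" using scale[OF one, of 0] by simp
  have word: "P (\<pi> (Poly_Mapping.single (Word w) 1))" for w
  proof (induction w)
    case Nil
    show ?case
      using one by (simp add: \<pi>_def one_weyl.abs_eq flip: zero_free_monoid_def)
  next
    case (Cons g w)
    have "Poly_Mapping.single (Word (g # w)) (1::'k) = fgen g * Poly_Mapping.single (Word w) 1"
      by (simp add: fgen_def mult_single plus_free_monoid_def)
    moreover have "\<pi> (fgen g) = (case g of GX i \<Rightarrow> wx i | GD i \<Rightarrow> wd i)"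
      by (cases g) (simp_all add: \<pi>_def wx.abs_eq wd.abs_eq)
    ultimately show ?case
      using wx[OF Cons] wd[OF Cons] by (cases g) (simp_all add: mult)
  qed
  have "P (\<pi> p)" for p
  proof (induction p rule: free_alg_induct)
    case zero
    then show ?case using P0 by (simp add: \<pi>_def zero_weyl.abs_eq)
  next
    case (single w c)
    have "Poly_Mapping.single w c = Poly_Mapping.single 0 c * Poly_Mapping.single w 1"
      by (simp add: mult_single)
    then have "\<pi> (Poly_Mapping.single w c) = c \<cdot> \<pi> (Poly_Mapping.single w 1)"
      by (simp add: \<pi>_def wscale.abs_eq)
    then show ?case using scale[OF word, of c "letters w"] by simp
  next
    case (add p q)
    then show ?case using assms(2) by (simp add: \<pi>_def plus_weyl.abs_eq[symmetric])
  qed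
  then show ?thesis unfolding \<pi>_def by (induction a rule: weyl.abs_induct)
qed

section \<open>Representations\<close>

text \<open>Modules over the Weyl algebra given by generators: linear operators satisfying the Weyl
  relations. The three instances are the target of an embedding, the twisted bimodule
  \<open>A\<close>, and formal power series.\<close>

locale weyl_rep = V: vector_space s
  for s :: "'k::field \<Rightarrow> 'v::ab_group_add \<Rightarrow> 'v" +
  fixes X D :: "'n \<Rightarrow> 'v \<Rightarrow> 'v"
  assumes X_add: "X i (v + w) = X i v + X i w"
    and X_scale: "X i (s c v) = s c (X i v)"
    and D_add: "D i (v + w) = D i v + D i w"
    and D_scale: "D i (s c v) = s c (D i v)"
    and XX: "X i (X j v) = X j (X i v)"
    and DD: "D i (D j v) = D j (D i v)"
    and DX: "D i (X j v) = X j (D i v) + (if i = j then v else 0)"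
begin

fun gen_op :: "'n gen \<Rightarrow> 'v \<Rightarrow> 'v" where
  "gen_op (GX i) = X i"
| "gen_op (GD i) = D i"

definition free_op :: "('k, 'n) free_alg \<Rightarrow> 'v \<Rightarrow> 'v" where
  "free_op p v = (\<Sum>w\<in>Poly_Mapping.keys p. s (Poly_Mapping.lookup p w) (foldr gen_op (letters w) v))"

lemma word_add: "foldr gen_op w (u + v) = foldr gen_op w u + foldr gen_op w v"
proof (induction w)
  case (Cons g w)
  then show ?case by (cases g) (simp_all add: X_add D_add)
qed simp

lemma word_scale: "foldr gen_op w (s c v) = s c (foldr gen_op w v)"
proof (induction w)
  case (Cons g w)
  then show ?case by (cases g) (simp_all add: X_scale D_scale)
qed simp

lemma free_op_superset:
  assumes "finite S" "Poly_Mapping.keys p \<subseteq> S"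
  shows "free_op p v = (\<Sum>w\<in>S. s (Poly_Mapping.lookup p w) (foldr gen_op (letters w) v))"
  unfolding free_op_def using assms
  by (intro sum.mono_neutral_left) (auto simp: in_keys_iff)

lemma free_op_add: "free_op (p + q) v = free_op p v + free_op q v"
proof -
  let ?S = "Poly_Mapping.keys p \<union> Poly_Mapping.keys q"
  have "Poly_Mapping.keys (p + q) \<subseteq> ?S" by (rule Poly_Mapping.keys_add)
  then show ?thesis
    by (simp add: free_op_superset[of ?S] lookup_add V.scale_left_distrib sum.distrib)
qed

lemma free_op_zero [simp]: "free_op 0 v = 0"
  by (simp add: free_op_def)

lemma free_op_single: "free_op (Poly_Mapping.single w c) v = s c (foldr gen_op (letters w) v)"
  by (subst free_op_superset[of "{w}"]) simp_all

lemma free_op_add_right: "free_op p (u + v) = free_op p u + free_op p v"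
  by (simp add: free_op_def word_add V.scale_right_distrib sum.distrib)

lemma free_op_scale_right: "free_op p (s c v) = s c (free_op p v)"
  by (simp add: free_op_def word_scale V.scale_left_commute V.scale_sum_right mult.commute)

lemma free_op_zero_right [simp]: "free_op p 0 = 0"
  using free_op_scale_right[of p 0 0] by simp

lemma free_op_mult: "free_op (p * q) v = free_op p (free_op q v)"
proof (induction p rule: free_alg_induct)
  case (single w c)
  show ?case
    by (induction q rule: free_alg_induct)
      (simp_all add: mult_single free_op_single plus_free_monoid_def word_scale distrib_left
        free_op_add free_op_add_right)
qed (simp_all add: distrib_right free_op_add)

lemma free_op_one [simp]: "free_op 1 v = v"
  by (simp add: free_op_single zero_free_monoid_def flip: single_one)

lemma free_op_diff: "free_op (p - q) v = free_op p v - free_op q v"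
  using free_op_add[of "p - q" q v] by simp

lemma free_op_fgen: "free_op (fgen g) = gen_op g"
  by (simp add: fun_eq_iff fgen_def free_op_single)

text \<open>The annihilator of the whole module is a two-sided ideal of the free algebra, and it
  contains the relators.\<close>

lemma free_op_weyl_ideal:
  assumes "p \<in> weyl_ideal"
  shows "free_op p v = 0"
proof -
  have "two_sided_ideal {p. \<forall>v. free_op p v = 0}"
    by (auto simp: two_sided_ideal_def left_ideal_def free_op_add free_op_mult)
  moreover have "weyl_relators \<subseteq> {p. \<forall>v. free_op p v = 0}"
    by (auto simp: weyl_relators_def commutator_def free_op_diff free_op_mult free_op_fgen
        XX DD DX)
  ultimately have "weyl_ideal \<subseteq> {p. \<forall>v. free_op p v = 0}"
    unfolding weyl_ideal_def by (intro hull_minimal)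
  then show ?thesis using assms by auto
qed

definition wact :: "('k, 'n) weyl \<Rightarrow> 'v \<Rightarrow> 'v" where
  "wact a = free_op (rep_weyl a)"

text \<open>Two representatives of a class differ by an element of \<open>weyl_ideal\<close>, which
  acts as \<open>0\<close>; so the choice made by \<open>rep_weyl\<close> does not matter.\<close>

lemma wact_abs: "wact (abs_weyl p) v = free_op p v"
proof -
  have "rep_weyl (abs_weyl p) - p \<in> weyl_ideal"
    by (metis Quotient3_abs_rep[OF Quotient3_weyl] weyl.abs_eq_iff)
  then show ?thesis
    using free_op_weyl_ideal[of "rep_weyl (abs_weyl p) - p"] by (simp add: wact_def free_op_diff)
qed

lemma wact_one [simp]: "wact 1 v = v"
  by (simp add: one_weyl.abs_eq wact_abs)

lemma wact_add: "wact (a + b) v = wact a v + wact b v"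
  by (induction a rule: weyl.abs_induct, induction b rule: weyl.abs_induct)
    (simp add: plus_weyl.abs_eq wact_abs free_op_add)

lemma wact_mult: "wact (a * b) v = wact a (wact b v)"
  by (induction a rule: weyl.abs_induct, induction b rule: weyl.abs_induct)
    (simp add: times_weyl.abs_eq wact_abs free_op_mult)

lemma wact_scale: "wact (c \<cdot> a) v = s c (wact a v)"
  by (induction a rule: weyl.abs_induct)
    (simp add: wscale.abs_eq wact_abs free_op_mult free_op_single zero_free_monoid_def)

lemma wact_wx [simp]: "wact (wx i) v = X i v"
  by (simp add: wx.abs_eq wact_abs free_op_fgen)

lemma wact_wd [simp]: "wact (wd i) v = D i v"
  by (simp add: wd.abs_eq wact_abs free_op_fgen)

lemma wact_diff: "wact (a - b) v = wact a v - wact b v"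
  using wact_add[of "a - b" b v] by simp

lemma wact_zero [simp]: "wact 0 v = 0"
  using wact_diff[of 0 0 v] by simp

lemma wact_zero_right [simp]: "wact a 0 = 0"
  by (simp add: wact_def)

end

section \<open>Algebra homomorphisms\<close>

lemma algebra_hom_simps:
  assumes "algebra_hom f"
  shows "f 1 = 1" "f (a + b) = f a + f b" "f (a * b) = f a * f b" "f (c \<cdot> a) = c \<cdot> f a"
    "f 0 = 0" "f (- a) = - f a" "f (a - b) = f a - f b"
proof -
  have add: "f (a + b) = f a + f b" for a b using assms by (simp add: algebra_hom_def)
  show "f 1 = 1" "f (a + b) = f a + f b" "f (a * b) = f a * f b" "f (c \<cdot> a) = c \<cdot> f a"
    using assms by (simp_all add: algebra_hom_def)
  show zero: "f 0 = 0" using add[of 0 0] by simp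
  show "f (- a) = - f a" using add[of a "- a"] by (simp add: zero eq_neg_iff_add_eq_0 add.commute)
  show "f (a - b) = f a - f b" using add[of "a - b" b] by simp
qed

lemma algebra_hom_eqI:
  assumes f: "algebra_hom f" and g: "algebra_hom g"
    and "\<And>i. f (wx i) = g (wx i)" "\<And>i. f (wd i) = g (wd i)"
  shows "f = g"
proof
  show "f a = g a" for a
    by (induction a rule: weyl_induct)
      (simp_all add: assms algebra_hom_simps[OF f] algebra_hom_simps[OF g])
qed

text \<open>The images of the generators act on the target algebra by left multiplication;
  injectivity of \<open>h\<close> gives the relation with Kronecker delta. The homomorphism is the
  orbit map of \<open>1\<close>.\<close>

lemma embed_ex1:
  fixes h :: "'n \<Rightarrow> 'm"
  assumes "inj h"
  shows "\<exists>!\<phi> :: ('k::field, 'n) weyl \<Rightarrow> ('k, 'm) weyl.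
    algebra_hom \<phi> \<and> (\<forall>i. \<phi> (wx i) = wx (h i) \<and> \<phi> (wd i) = wd (h i))"
proof -
  interpret weyl_rep "wscale :: 'k \<Rightarrow> ('k, 'm) weyl \<Rightarrow> _" "\<lambda>i. (*) (wx (h i))" "\<lambda>i. (*) (wd (h i))"
  proof
    show "wx (h i) * (wx (h j) * v) = wx (h j) * (wx (h i) * v)"
      "wd (h i) * (wd (h j) * v) = wd (h j) * (wd (h i) * v)"
      "wd (h i) * (wx (h j) * v) = wx (h j) * (wd (h i) * v) + (if i = j then v else 0)"
      for i j and v :: "('k, 'm) weyl"
      using assms by (auto simp: wx_wx wd_wd wd_wx distrib_right inj_eq simp flip: mult.assoc)
  qed (simp_all add: distrib_left wscale_mult_right)
  \<comment> \<open>Each \<open>a\<close> acts as left multiplication by its value at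
    \<open>1\<close>, which makes the orbit map multiplicative.\<close>
  have left: "wact a v = wact a 1 * v" for a v
    by (induction a rule: weyl_induct)
      (simp_all add: wact_add wact_scale wact_mult distrib_right wscale_mult_left mult.assoc)
  have "wact (a * b) 1 = wact a 1 * wact b 1" for a b
    unfolding wact_mult by (rule left)
  then have "algebra_hom (\<lambda>a. wact a 1)"
    by (simp add: algebra_hom_def wact_add wact_scale)
  then have "\<exists>\<phi> :: ('k::field, 'n) weyl \<Rightarrow> ('k, 'm) weyl.
    algebra_hom \<phi> \<and> (\<forall>i. \<phi> (wx i) = wx (h i) \<and> \<phi> (wd i) = wd (h i))"
    by (intro exI[of _ "\<lambda>a. wact a 1"]) simp
  then show ?thesis by (rule ex_ex1I) (rule algebra_hom_eqI; simp)
qed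

lemma
  fixes h :: "'n \<Rightarrow> 'm"
  assumes "inj h"
  shows algebra_hom_embed: "algebra_hom (embed h :: ('k::field, 'n) weyl \<Rightarrow> ('k, 'm) weyl)"
    and embed_wx: "embed h (wx i) = (wx (h i) :: ('k, 'm) weyl)"
    and embed_wd: "embed h (wd i) = (wd (h i) :: ('k, 'm) weyl)"
  using theI'[OF embed_ex1[OF assms, where 'k = 'k]] unfolding embed_def by auto

lemmas embed_simps =
  algebra_hom_simps[OF algebra_hom_embed[OF inj_Inl]] embed_wx[OF inj_Inl] embed_wd[OF inj_Inl]
  algebra_hom_simps[OF algebra_hom_embed[OF inj_Inr]] embed_wx[OF inj_Inr] embed_wd[OF inj_Inr]

lemma commutes_mult:
  fixes x :: "'r::semigroup_mult"
  assumes "x * a = a * x" "x * b = b * x"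
  shows "x * (a * b) = a * b * x"
proof -
  have "x * (a * b) = a * (x * b)" by (simp add: assms(1) flip: mult.assoc)
  then show ?thesis by (simp add: assms(2) mult.assoc)
qed

lemma commutes_embed_Inr:
  assumes "\<And>i. x * wx (Inr i) = wx (Inr i) * x" "\<And>i. x * wd (Inr i) = wd (Inr i) * x"
  shows "x * embed Inr b = embed Inr b * x"
  by (induction b rule: weyl_induct)
    (simp_all add: embed_simps distrib_left distrib_right wscale_mult_left wscale_mult_right
      commutes_mult assms)

lemma embed_commute: "embed Inl a * embed Inr b = embed Inr b * embed Inl a"
proof -
  \<comment> \<open>Indices from different summands are never equal, so the delta term in
    \<open>wd_wx\<close> vanishes.\<close>
  have "wd (Inr j) * wx (Inl i) = wx (Inl i) * wd (Inr j)"
    "wd (Inl i) * wx (Inr j) = wx (Inr j) * wd (Inl i)" for i j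
    by (simp_all add: wd_wx)
  note * = this
  have comm: "embed Inr b * wx (Inl i) = wx (Inl i) * embed Inr b"
    "embed Inr b * wd (Inl i) = wd (Inl i) * embed Inr b" for i
    by (intro commutes_embed_Inr[symmetric] wx_wx wd_wd * *[symmetric])+
  have "embed Inr b * embed Inl a = embed Inl a * embed Inr b"
    by (induction a rule: weyl_induct)
      (simp_all add: embed_simps distrib_left distrib_right wscale_mult_left wscale_mult_right
        commutes_mult comm)
  then show ?thesis by (rule sym)
qed

section \<open>Closure properties of left ideals\<close>

lemma left_ideal_hull: "left_ideal (left_ideal hull S)"
  by (rule hull_in) (auto simp: left_ideal_def)

lemma left_ideal_zero: "left_ideal I \<Longrightarrow> 0 \<in> I"
  and left_ideal_add: "left_ideal I \<Longrightarrow> a \<in> I \<Longrightarrow> b \<in> I \<Longrightarrow> a + b \<in> I"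
  and left_ideal_mult: "left_ideal I \<Longrightarrow> a \<in> I \<Longrightarrow> r * a \<in> I"
  by (simp_all add: left_ideal_def)

lemma left_ideal_minus: "left_ideal I \<Longrightarrow> a \<in> I \<Longrightarrow> - a \<in> I"
  for a :: "'r::ring_1"
  using left_ideal_mult[of I a "- 1"] by simp

lemma left_ideal_scale: "left_ideal I \<Longrightarrow> a \<in> I \<Longrightarrow> c \<cdot> a \<in> I"
  using left_ideal_mult[of I a "c \<cdot> 1"] by (simp add: wscale_mult_left)

section \<open>The ideal of an endomorphism\<close>

text \<open>
  \<open>A\<close> as a module over \<^typ>\<open>('k, 'n + 'n) weyl\<close>: the first copy of \<open>A\<close> acts by left
  multiplication, and the second one by right multiplication twisted by \<open>f\<close>, where the sign of
  \<open>\<partial>\<close> accounts for the reversed order of multiplication.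
\<close>

locale endo =
  fixes f :: "('k::field, 'n) weyl \<Rightarrow> ('k, 'n) weyl"
  assumes f: "algebra_hom f"
begin

lemmas f_simps = algebra_hom_simps[OF f]

definition bimod_x :: "'n + 'n \<Rightarrow> ('k, 'n) weyl \<Rightarrow> ('k, 'n) weyl" where
  "bimod_x j a = (case j of Inl i \<Rightarrow> wx i * a | Inr i \<Rightarrow> a * f (wx i))"

definition bimod_d :: "'n + 'n \<Rightarrow> ('k, 'n) weyl \<Rightarrow> ('k, 'n) weyl" where
  "bimod_d j a = (case j of Inl i \<Rightarrow> wd i * a | Inr i \<Rightarrow> - (a * f (wd i)))"

lemma bimod_simps [simp]:
  "bimod_x (Inl i) a = wx i * a" "bimod_x (Inr i) a = a * f (wx i)"
  "bimod_d (Inl i) a = wd i * a" "bimod_d (Inr i) a = - (a * f (wd i))"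
  by (simp_all add: bimod_x_def bimod_d_def)

sublocale bimod: weyl_rep wscale bimod_x bimod_d
proof
  fix i j :: "'n + 'n" and a :: "('k, 'n) weyl"
  have fxx: "f (wx i) * f (wx j) = f (wx j) * f (wx i)"
    and fdd: "f (wd i) * f (wd j) = f (wd j) * f (wd i)"
    and fdx: "f (wd i) * f (wx j) = f (wx j) * f (wd i) + (if i = j then 1 else 0)" for i j
    unfolding f_simps(3)[symmetric] by (simp_all add: wx_wx wd_wd wd_wx f_simps)
  show "bimod_x i (bimod_x j a) = bimod_x j (bimod_x i a)"
    by (cases i; cases j) (simp_all add: bimod_x_def wx_wx fxx mult.assoc,
        simp add: wx_wx flip: mult.assoc)
  show "bimod_d i (bimod_d j a) = bimod_d j (bimod_d i a)"
    by (cases i; cases j) (simp_all add: bimod_d_def wd_wd fdd mult.assoc,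
        simp add: wd_wd flip: mult.assoc)
  show "bimod_d i (bimod_x j a) = bimod_x j (bimod_d i a) + (if i = j then a else 0)"
  proof (cases i; cases j)
    fix i' j' assume "i = Inl i'" "j = Inl j'"
    then show ?thesis
      using arg_cong[OF wd_wx[of i' j'], of "\<lambda>b. b * a"]
      by (auto simp: bimod_x_def bimod_d_def mult.assoc distrib_right)
  next
    \<comment> \<open>Right multiplications compose in reversed order, so their commutator has the
      opposite sign; the minus in \<open>bimod_d\<close> restores the Weyl relation. The mixed cases
      are associativity.\<close>
    fix i' j' assume "i = Inr i'" "j = Inr j'"
    then show ?thesis
      using arg_cong[OF fdx[of i' j'], of "\<lambda>b. a * b"]
      by (auto simp: bimod_x_def bimod_d_def mult.assoc distrib_left)
  qed (simp_all add: bimod_x_def bimod_d_def mult.assoc)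
qed (auto simp: bimod_x_def bimod_d_def distrib_left distrib_right wscale_mult_left
    wscale_mult_right split: sum.split)

text \<open>The orbit map of the cyclic vector \<open>1\<close>. It is linear over the big Weyl
  algebra, so its kernel is a left ideal; it need not be multiplicative.\<close>

definition eps :: "('k, 'n + 'n) weyl \<Rightarrow> ('k, 'n) weyl" where
  "eps u = bimod.wact u 1"

lemma wact_embed_Inl: "bimod.wact (embed Inl a) b = a * b"
  by (induction a rule: weyl_induct)
    (simp_all add: embed_simps bimod.wact_add bimod.wact_scale bimod.wact_mult distrib_right
      wscale_mult_left mult.assoc)

lemma eps_embed_Inl [simp]: "eps (embed Inl a) = a"
  by (simp add: eps_def wact_embed_Inl)

lemma eps_simps:
  "eps (a + b) = eps a + eps b" "eps (a - b) = eps a - eps b" "eps (c \<cdot> a) = c \<cdot> eps a"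
  "eps 1 = 1" "eps 0 = 0"
  "eps (wx (Inl i) * a) = wx i * eps a" "eps (wd (Inl i) * a) = wd i * eps a"
  "eps (wx (Inr i) * a) = eps a * f (wx i)" "eps (wd (Inr i) * a) = - (eps a * f (wd i))"
  by (simp_all add: eps_def bimod.wact_add bimod.wact_diff bimod.wact_scale bimod.wact_mult)

lemma eps_gens:
  "eps (wx (Inl i)) = wx i" "eps (wd (Inl i)) = wd i"
  "eps (wx (Inr i)) = f (wx i)" "eps (wd (Inr i)) = - f (wd i)"
  using eps_simps(6-9)[of i 1] by (simp_all add: eps_simps(4))

lemma left_ideal_ker_eps: "left_ideal {u. eps u = 0}"
  by (auto simp: left_ideal_def eps_simps) (simp add: eps_def bimod.wact_mult)

text \<open>Modulo \<open>J\<close> every element reduces to one of the first copy: a generator of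
  the second copy is moved to the right past elements of the first copy, where a generator of
  \<open>J\<close> replaces it by its value under \<open>f\<close> up to sign.\<close>

lemma diff_eps_in_endo_ideal: "u - embed Inl (eps u) \<in> endo_ideal f"
proof -
  let ?J = "endo_ideal f"
  have J: "left_ideal ?J"
    unfolding endo_ideal_def by (rule left_ideal_hull)
  have gx: "wx (Inr i) - embed Inl (f (wx i)) \<in> ?J"
    and gd: "wd (Inr i) + embed Inl (f (wd i)) \<in> ?J" for i
    unfolding endo_ideal_def by (auto intro: hull_inc)
  show ?thesis
  proof (induction u rule: weyl_induct)
    case one
    then show ?case by (simp add: eps_simps embed_simps left_ideal_zero[OF J])
  next
    case (add a b)
    then have "(a - embed Inl (eps a)) + (b - embed Inl (eps b)) \<in> ?J"
      by (rule left_ideal_add[OF J])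
    then show ?case by (simp add: eps_simps embed_simps algebra_simps)
  next
    case (scale c a)
    then show ?case
      using left_ideal_scale[OF J, of "a - embed Inl (eps a)" c]
      by (simp add: eps_simps embed_simps weyl_vs.scale_right_diff_distrib)
  next
    case (wx j a)
    note IH = left_ideal_mult[OF J wx, of "wx j"]
    show ?case
    proof (cases j)
      case (Inl i)
      then show ?thesis using IH by (simp add: eps_simps embed_simps right_diff_distrib)
    next
      case (Inr i)
      \<comment> \<open>The second summand trades the trailing \<open>wx (Inr i)\<close> for
        \<open>f (wx i)\<close>; the two middle terms cancel because the copies commute.\<close>
      have "wx j * (a - embed Inl (eps a))
          + embed Inl (eps a) * (wx (Inr i) - embed Inl (f (wx i))) \<in> ?J"
        by (intro left_ideal_add[OF J] IH left_ideal_mult[OF J] gx)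
      moreover have "embed Inl (eps a) * wx (Inr i) = wx (Inr i) * embed Inl (eps a)"
        using embed_commute[of "eps a" "wx i"] by (simp add: embed_simps)
      ultimately show ?thesis
        by (simp add: Inr eps_simps embed_simps right_diff_distrib)
    qed
  next
    case (wd j a)
    note IH = left_ideal_mult[OF J wd, of "wd j"]
    show ?case
    proof (cases j)
      case (Inl i)
      then show ?thesis using IH by (simp add: eps_simps embed_simps right_diff_distrib)
    next
      case (Inr i)
      have "wd j * (a - embed Inl (eps a))
          + embed Inl (eps a) * (wd (Inr i) + embed Inl (f (wd i))) \<in> ?J"
        by (intro left_ideal_add[OF J] IH left_ideal_mult[OF J] gd)
      moreover have "embed Inl (eps a) * wd (Inr i) = wd (Inr i) * embed Inl (eps a)"
        using embed_commute[of "eps a" "wd i"] by (simp add: embed_simps)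
      ultimately show ?thesis
        by (simp add: Inr eps_simps embed_simps right_diff_distrib distrib_left)
    qed
  qed
qed

lemma endo_ideal_eq_ker: "endo_ideal f = {u. eps u = 0}"
proof
  have "left_ideal hull (range (\<lambda>i. wx (Inr i) - embed Inl (f (wx i))) \<union>
      range (\<lambda>i. wd (Inr i) + embed Inl (f (wd i)))) \<subseteq> {u. eps u = 0}"
    by (intro hull_minimal left_ideal_ker_eps) (auto simp: eps_simps eps_gens)
  then show "endo_ideal f \<subseteq> {u. eps u = 0}" by (simp add: endo_ideal_def)
next
  show "{u. eps u = 0} \<subseteq> endo_ideal f"
    using diff_eps_in_endo_ideal by (auto simp: embed_simps) (metis diff_zero embed_simps(5))
qed

end

section \<open>Injectivity of the two embeddings, and the second copy as a range\<close>

lemma inj_embed_Inl: "inj (embed Inl :: ('k::field, 'n) weyl \<Rightarrow> ('k, 'n + 'n) weyl)"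
proof -
  \<comment> \<open>The map \<open>eps\<close> is a left inverse of \<open>embed Inl\<close> for
    every endomorphism; the identity is a convenient choice.\<close>
  interpret endo "id :: ('k, 'n) weyl \<Rightarrow> _"
    by unfold_locales (simp add: algebra_hom_def)
  show ?thesis by (rule inj_on_inverseI[of _ eps]) simp
qed

text \<open>Exchanging the two copies turns \<open>embed Inr\<close> into \<open>embed Inl\<close>,
  whose injectivity is known.\<close>

lemma inj_embed_Inr: "inj (embed Inr :: ('k::field, 'n) weyl \<Rightarrow> ('k, 'n + 'n) weyl)"
proof -
  define swap :: "'n + 'n \<Rightarrow> 'n + 'n" where "swap = case_sum Inr Inl"
  have swap: "swap (Inl i) = Inr i" "swap (Inr i) = Inl i" for i by (simp_all add: swap_def)
  have "inj swap" by (auto simp: swap_def inj_def split: sum.splits)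
  note sw = algebra_hom_simps[OF algebra_hom_embed[OF this]] embed_wx[OF this] embed_wd[OF this]
  have "embed swap (embed Inr a) = (embed Inl a :: ('k, 'n + 'n) weyl)" for a :: "('k, 'n) weyl"
    by (induction a rule: weyl_induct) (simp_all add: embed_simps sw swap)
  then show ?thesis by (metis inj_embed_Inl injD injI)
qed

lemma subalgebra_hull: "subalgebra (subalgebra hull S)"
  by (rule hull_in) (auto simp: subalgebra_def)

lemma subalgebra_range:
  assumes "algebra_hom f"
  shows "subalgebra (range f)"
  unfolding subalgebra_def
  by (auto simp flip: algebra_hom_simps[OF assms])

lemma second_copy_eq_range:
  "second_copy = range (embed Inr :: ('k::field, 'n) weyl \<Rightarrow> ('k, 'n + 'n) weyl)"
proof
  show "second_copy \<subseteq> range (embed Inr :: ('k::field, 'n) weyl \<Rightarrow> ('k, 'n + 'n) weyl)"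
    unfolding second_copy_def
    by (intro hull_minimal subalgebra_range algebra_hom_embed)
      (auto simp flip: embed_simps(17,18))
next
  have S: "subalgebra (second_copy :: ('k, 'n + 'n) weyl set)"
    unfolding second_copy_def by (rule subalgebra_hull)
  have "wx (Inr i) \<in> second_copy" "wd (Inr i) \<in> second_copy" for i :: 'n
    unfolding second_copy_def by (auto intro: hull_inc)
  then have "embed Inr a \<in> (second_copy :: ('k, 'n + 'n) weyl set)" for a
    using S by (induction a rule: weyl_induct) (auto simp: embed_simps subalgebra_def)
  then show "range (embed Inr) \<subseteq> (second_copy :: ('k, 'n + 'n) weyl set)" by auto
qed

lemma inv_embed_Inr [simp]:
  fixes a :: "('k::field, 'n) weyl"
  shows "inv (embed Inr :: _ \<Rightarrow> ('k, 'n + 'n) weyl) (embed Inr a) = a"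
  by (rule inv_f_f[OF inj_embed_Inr])

lemma on_second_copy_gens:
  "on_second_copy g (wx (Inr i)) = embed Inr (g (wx i))"
  "on_second_copy g (wd (Inr i)) = embed Inr (g (wd i))"
  by (simp_all add: on_second_copy_def flip: embed_simps(17,18))

section \<open>Bijectivity and surjectivity of endomorphisms\<close>

lemma invertible_endo_iff:
  assumes f: "algebra_hom f"
  shows "invertible_endo f \<longleftrightarrow> bij f"
proof
  assume "invertible_endo f"
  then show "bij f" unfolding invertible_endo_def by (metis o_bij)
next
  assume "bij f"
  then have inv: "f (inv f a) = a" "inv f (f a) = a" for a
    by (simp_all add: bij_def surj_f_inv_f)
  have "algebra_hom (inv f)"
    unfolding algebra_hom_def
    by (metis inv algebra_hom_simps(1-4)[OF f])
  then show "invertible_endo f"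
    unfolding invertible_endo_def using f inv by (auto simp: fun_eq_iff intro!: exI[of _ "inv f"])
qed

lemma surj_if_gens_in_range:
  assumes f: "algebra_hom f" and "\<And>i. wx i \<in> range f" "\<And>i. wd i \<in> range f"
  shows "surj f"
proof -
  define R where "R = range f"
  have "subalgebra R" "\<And>i. wx i \<in> R" "\<And>i. wd i \<in> R"
    using assms subalgebra_range[OF f] by (auto simp: R_def)
  then have "a \<in> R" for a
    by (induction a rule: weyl_induct) (auto simp: subalgebra_def)
  then show ?thesis by (auto simp: R_def)
qed

section \<open>The antihomomorphism and the action of the second copy\<close>

locale endo_antihom = endo f
  for f :: "('k::field, 'n) weyl \<Rightarrow> ('k, 'n) weyl" +
  fixes \<tau> :: "('k, 'n + 'n) weyl \<Rightarrow> ('k, 'n + 'n) weyl"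
  assumes \<tau>: "algebra_antihom_on second_copy \<tau>"
    and \<tau>_x: "\<And>i. \<tau> (wx (Inr i)) = wx (Inr i)"
    and \<tau>_d: "\<And>i. \<tau> (wd (Inr i)) = - wd (Inr i)"
begin

text \<open>The map \<open>\<tau>\<close> transported to \<open>A\<close>: the formal adjoint of
  differential operators, an involution that reverses products.\<close>

definition adj :: "('k, 'n) weyl \<Rightarrow> ('k, 'n) weyl" where
  "adj a = inv (embed Inr) (\<tau> (embed Inr a))"

lemma \<tau>_second_copy: "a \<in> second_copy \<Longrightarrow> \<tau> a \<in> second_copy"
  using \<tau> by (auto simp: algebra_antihom_on_def)

lemma \<tau>_embed: "\<tau> (embed Inr a) = embed Inr (adj a)"
  unfolding adj_def
  by (metis \<tau>_second_copy f_inv_into_f rangeI second_copy_eq_range)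

lemma adj_simps:
  "adj 1 = 1" "adj (a + b) = adj a + adj b" "adj (a * b) = adj b * adj a"
  "adj (c \<cdot> a) = c \<cdot> adj a" "adj (wx i) = wx i" "adj (wd i) = - wd i"
proof -
  have [simp]: "embed Inr a \<in> (second_copy :: ('k, 'n + 'n) weyl set)" for a
    by (simp add: second_copy_eq_range)
  note h = \<tau>[unfolded algebra_antihom_on_def]
  have "embed Inr (adj 1) = (embed Inr 1 :: ('k, 'n + 'n) weyl)"
    "embed Inr (adj (a + b)) = (embed Inr (adj a + adj b) :: ('k, 'n + 'n) weyl)"
    "embed Inr (adj (a * b)) = (embed Inr (adj b * adj a) :: ('k, 'n + 'n) weyl)"
    "embed Inr (adj (c \<cdot> a)) = (embed Inr (c \<cdot> adj a) :: ('k, 'n + 'n) weyl)"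
    "embed Inr (adj (wx i)) = (embed Inr (wx i) :: ('k, 'n + 'n) weyl)"
    "embed Inr (adj (wd i)) = (embed Inr (- wd i) :: ('k, 'n + 'n) weyl)"
    using h by (simp_all add: \<tau>_x \<tau>_d embed_simps flip: \<tau>_embed)
  then show "adj 1 = 1" "adj (a + b) = adj a + adj b"
    "adj (a * b) = adj b * adj a"
    "adj (c \<cdot> a) = c \<cdot> adj a" "adj (wx i) = wx i" "adj (wd i) = - wd i"
    by (simp_all add: inj_eq[OF inj_embed_Inr])
qed

lemma adj_minus: "adj (- a) = - adj a"
  using adj_simps(4)[of "- 1" a] by simp

lemma adj_adj [simp]: "adj (adj a) = a"
  by (induction a rule: weyl_induct) (simp_all add: adj_simps adj_minus)

text \<open>The second copy acts by right multiplications, so products act in reversed order;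
  \<open>adj\<close> compensates for this order and for the sign of the derivations.\<close>

lemma eps_embed_Inr: "eps (embed Inr a) = f (adj a)"
proof -
  have "bimod.wact (embed Inr a) b = b * f (adj a)" for b
    by (induction a arbitrary: b rule: weyl_induct)
      (simp_all add: embed_simps bimod.wact_add bimod.wact_scale bimod.wact_mult distrib_left
        wscale_mult_right mult.assoc adj_simps f_simps)
  then show ?thesis by (simp add: eps_def)
qed

text \<open>The generators of \<open>?K\<close> are killed by \<open>eps\<close>. Conversely, modulo
  \<open>?K\<close> each \<open>a\<close> in the first copy is congruent to
  \<open>adj (inv f a)\<close> in the second; applied to the values of \<open>f\<close>, this yields
  the generators of \<open>J\<close>.\<close>

lemma endo_ideal_eq_graph_ideal:
  assumes "bij f"
  shows "endo_ideal f = left_ideal hull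
      (range (\<lambda>i. wx (Inl i) - embed Inr (adj (inv f (wx i)))) \<union>
       range (\<lambda>i. wd (Inl i) - embed Inr (adj (inv f (wd i)))))" (is "_ = ?K")
proof
  have inv: "f (inv f a) = a" "inv f (f a) = a" for a
    using assms by (simp_all add: bij_def surj_f_inv_f)
  have g: "algebra_hom (inv f)"
    unfolding algebra_hom_def by (metis inv f_simps(1-4))
  note g_simps = algebra_hom_simps[OF g]
  show "?K \<subseteq> endo_ideal f"
    unfolding endo_ideal_eq_ker
    by (intro hull_minimal left_ideal_ker_eps)
      (auto simp: eps_simps eps_gens eps_embed_Inr inv)
  have K: "left_ideal ?K" by (rule left_ideal_hull)
  have gx: "wx (Inl i) - embed Inr (adj (inv f (wx i))) \<in> ?K"
    and gd: "wd (Inl i) - embed Inr (adj (inv f (wd i))) \<in> ?K" for i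
    by (auto intro: hull_inc)
  \<comment> \<open>The congruence passes to products: \<open>adj\<close> puts the factor belonging
    to \<open>c\<close> on the right, so after \<open>u\<close> has commuted past the other factor,
    the congruence for \<open>c\<close> applies.\<close>
  have mult: "u * embed Inl a - embed Inr (adj (inv f (c * a))) \<in> ?K"
    if c: "u - embed Inr (adj (inv f c)) \<in> ?K" and u: "u = embed Inl c"
      and IH: "embed Inl a - embed Inr (adj (inv f a)) \<in> ?K" for u a c
  proof -
    have "u * (embed Inl a - embed Inr (adj (inv f a)))
        + embed Inr (adj (inv f a)) * (u - embed Inr (adj (inv f c))) \<in> ?K"
      by (intro left_ideal_add[OF K] left_ideal_mult[OF K] c IH)
    moreover have "u * embed Inr (adj (inv f a)) = embed Inr (adj (inv f a)) * u"
      by (simp add: u embed_commute)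
    ultimately show ?thesis
      by (simp add: g_simps adj_simps embed_simps right_diff_distrib)
  qed
  have K_cong: "embed Inl a - embed Inr (adj (inv f a)) \<in> ?K" for a
  proof (induction a rule: weyl_induct)
    case one
    then show ?case by (simp add: g_simps adj_simps embed_simps left_ideal_zero[OF K])
  next
    case (add a b)
    from left_ideal_add[OF K this] show ?case
      by (simp add: g_simps adj_simps embed_simps algebra_simps)
  next
    case (scale c a)
    from left_ideal_scale[OF K this, of c] show ?case
      by (simp add: g_simps adj_simps embed_simps weyl_vs.scale_right_diff_distrib)
  next
    case (wx i a)
    from mult[OF gx _ wx] show ?case by (simp add: embed_simps)
  next
    case (wd i a)
    from mult[OF gd _ wd] show ?case by (simp add: embed_simps)
  qed
  show "endo_ideal f \<subseteq> ?K"
    unfolding endo_ideal_def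
  proof (intro hull_minimal K Un_least image_subsetI)
    fix i
    \<comment> \<open>Here \<open>inv f\<close> cancels \<open>f\<close>. Since \<open>adj\<close>
      fixes \<open>wx i\<close> and negates \<open>wd i\<close>, the two families of generators
      carry different signs.\<close>
    show "wx (Inr i) - embed Inl (f (wx i)) \<in> ?K"
      using left_ideal_minus[OF K K_cong[of "f (wx i)"]]
      by (simp add: inv adj_simps embed_simps)
    show "wd (Inr i) + embed Inl (f (wd i)) \<in> ?K"
      using K_cong[of "f (wd i)"] by (simp add: inv adj_simps embed_simps add.commute)
  qed
qed

lemma second_copy_inter_endo_ideal:
  assumes "inj f" "b \<in> second_copy" "b \<in> endo_ideal f"
  shows "b = 0"
proof -
  obtain a where a: "b = embed Inr a" using assms(2) by (auto simp: second_copy_eq_range)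
  have "f (adj a) = f 0" using assms(3) by (simp add: a endo_ideal_eq_ker eps_embed_Inr f_simps)
  then have "adj (adj a) = adj 0" using assms(1) by (metis injD)
  then show ?thesis using adj_simps(4)[of 0 0] by (simp add: a embed_simps)
qed

lemma eps_eq_if_in_endo_ideal:
  assumes "u - embed Inr b \<in> endo_ideal f"
  shows "f (adj b) = eps u"
  using assms by (simp add: endo_ideal_eq_ker eps_simps eps_embed_Inr)

end

section \<open>The basis of monomials\<close>

text \<open>One half of a monomial: the family \<open>y\<close> is \<open>wx\<close> or
  \<open>wd\<close>, so both halves share the rules for commuting powers.\<close>

definition cmon :: "('n::enum \<Rightarrow> 'r::monoid_mult) \<Rightarrow> ('n \<Rightarrow> nat) \<Rightarrow> 'r" where
  "cmon y \<alpha> = prod_list (map (\<lambda>i. y i ^ \<alpha> i) enum_class.enum)"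

lemma wmonom_eq_cmon: "wmonom (\<alpha>, \<beta>) = cmon wx \<alpha> * cmon wd \<beta>"
  by (simp add: wmonom_def cmon_def)

lemma prod_list_commute:
  fixes z :: "'r::monoid_mult"
  assumes "\<And>j. z * y j = y j * z"
  shows "z * prod_list (map (\<lambda>i. y i ^ \<alpha> i) L) = prod_list (map (\<lambda>i. y i ^ \<alpha> i) L) * z"
proof (induction L)
  case (Cons a L)
  have "z * y a ^ \<alpha> a = y a ^ \<alpha> a * z"
    by (rule power_commuting_commutes[OF assms[symmetric], symmetric])
  from commutes_mult[OF this Cons] show ?case by simp
qed simp

lemma cmon_mult:
  assumes comm: "\<And>i j. y i * y j = y j * y i"
  shows "cmon y \<alpha> * cmon y \<gamma> = cmon y (\<lambda>i. \<alpha> i + \<gamma> i)"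
proof -
  let ?P = "\<lambda>\<alpha> L. prod_list (map (\<lambda>i. y i ^ \<alpha> i) L)"
  have "?P \<alpha> L * ?P \<gamma> L = ?P (\<lambda>i. \<alpha> i + \<gamma> i) L" for L
  proof (induction L)
    case (Cons a L)
    have "y a ^ \<gamma> a * ?P \<alpha> L = ?P \<alpha> L * y a ^ \<gamma> a"
      by (rule prod_list_commute) (rule power_commuting_commutes[OF comm])
    then have "?P \<alpha> (a # L) * ?P \<gamma> (a # L) = y a ^ \<alpha> a * (y a ^ \<gamma> a * ?P \<alpha> L) * ?P \<gamma> L"
      by (simp add: mult.assoc)
    also have "\<dots> = y a ^ (\<alpha> a + \<gamma> a) * (?P \<alpha> L * ?P \<gamma> L)"
      by (simp add: mult.assoc power_add)
    finally show ?case by (simp add: Cons)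
  qed simp
  then show ?thesis by (simp add: cmon_def)
qed

lemma cmon_zero [simp]: "cmon y (\<lambda>_. 0) = 1"
proof -
  have "prod_list (map (\<lambda>i. y i ^ 0) L) = 1" for L by (induction L) simp_all
  then show ?thesis by (simp add: cmon_def)
qed

lemma cmon_single: "cmon y (\<lambda>j. if j = i then 1 else 0) = y i"
proof -
  have "distinct L \<Longrightarrow>
      prod_list (map (\<lambda>j. y j ^ (if j = i then 1 else 0)) L) = (if i \<in> set L then y i else 1)" for L
    by (induction L) auto
  from this[OF enum_distinct] show ?thesis by (simp add: cmon_def UNIV_enum[symmetric])
qed

lemma mult_cmon:
  assumes comm: "\<And>i j. y i * y j = y j * y i"
  shows "y i * cmon y \<alpha> = cmon y (\<lambda>j. (if j = i then 1 else 0) + \<alpha> j)"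
  using cmon_mult[where y = y, OF comm, of "\<lambda>j. if j = i then 1 else 0" \<alpha>] by (simp add: cmon_single)

text \<open>
  The formal power series in \<open>x\<close> of \<^const>\<open>act\<close> do not separate the elements of the Weyl algebra
  in positive characteristic (\<open>\<partial>\<^sup>p\<close> acts as \<open>0\<close>).  Letting \<open>\<partial>\<^sub>i\<close> act as \<open>y\<^sub>i + d/dx\<^sub>i\<close> on series
  in \<open>x\<close> and \<open>y\<close> repairs this: \<open>x\<^sup>\<alpha>\<partial>\<^sup>\<beta>\<close> maps the series \<open>1\<close> to \<open>x\<^sup>\<alpha>y\<^sup>\<beta>\<close>.
\<close>

type_synonym ('k, 'n) series = "'n monomial \<Rightarrow> 'k"

definition ser_scale :: "'k::field \<Rightarrow> ('k, 'n) series \<Rightarrow> ('k, 'n) series" where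
  "ser_scale c F = (\<lambda>m. c * F m)"

definition ser_x :: "'n \<Rightarrow> ('k::field, 'n) series \<Rightarrow> ('k, 'n) series" where
  "ser_x i F = (\<lambda>(\<alpha>, \<beta>). if \<alpha> i = 0 then 0 else F (\<alpha>(i := \<alpha> i - 1), \<beta>))"

definition ser_d :: "'n \<Rightarrow> ('k::field, 'n) series \<Rightarrow> ('k, 'n) series" where
  "ser_d i F = (\<lambda>(\<alpha>, \<beta>). (if \<beta> i = 0 then 0 else F (\<alpha>, \<beta>(i := \<beta> i - 1))) +
     of_nat (Suc (\<alpha> i)) * F (\<alpha>(i := Suc (\<alpha> i)), \<beta>))"

lemma ser_x_apply: "ser_x i F (\<alpha>, \<beta>) = (if \<alpha> i = 0 then 0 else F (\<alpha>(i := \<alpha> i - 1), \<beta>))"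
  by (simp add: ser_x_def)

lemma ser_d_apply:
  "ser_d i F (\<alpha>, \<beta>) = (if \<beta> i = 0 then 0 else F (\<alpha>, \<beta>(i := \<beta> i - 1))) +
    of_nat (Suc (\<alpha> i)) * F (\<alpha>(i := Suc (\<alpha> i)), \<beta>)"
  by (simp add: ser_d_def)

interpretation ser: weyl_rep ser_scale ser_x ser_d
proof
  fix i j :: 'n and F :: "('k::field, 'n) series"
  show "ser_x i (ser_x j F) = ser_x j (ser_x i F)"
    by (auto simp: ser_x_def fun_eq_iff fun_upd_twist)
  show "ser_d i (ser_d j F) = ser_d j (ser_d i F)"
    by (cases "i = j") (auto simp: ser_d_def fun_eq_iff fun_upd_twist distrib_left mult.left_commute add_ac)
  show "ser_d i (ser_x j F) = ser_x j (ser_d i F) + (if i = j then F else 0)"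
    by (cases "i = j") (auto simp: ser_x_def ser_d_def fun_eq_iff fun_upd_twist algebra_simps)
qed (auto simp: ser_scale_def ser_x_def ser_d_def fun_eq_iff algebra_simps)

definition monom_series :: "'n monomial \<Rightarrow> ('k::field, 'n) series" where
  "monom_series m = (\<lambda>m'. if m' = m then 1 else 0)"

lemma ser_x_monom: "ser_x i (monom_series (\<alpha>, \<beta>)) = monom_series (\<alpha>(i := Suc (\<alpha> i)), \<beta>)"
  by (auto simp: ser_x_def monom_series_def fun_eq_iff split: if_splits)

text \<open>With no \<open>x\<close> in the monomial the derivative vanishes, and only
  multiplication by \<open>y\<close> remains.\<close>

lemma ser_d_monom:
  "ser_d i (monom_series (\<lambda>_. 0, \<beta>)) = monom_series (\<lambda>_. 0, \<beta>(i := Suc (\<beta> i)))"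
  by (auto simp: ser_d_def monom_series_def fun_eq_iff split: if_splits)

lemma cmon_wx_monom:
  "ser.wact (cmon wx \<gamma>) (monom_series (\<alpha>, \<beta>)) = monom_series (\<lambda>i. \<alpha> i + \<gamma> i, \<beta>)"
proof -
  have pow: "ser.wact (wx i ^ k) (monom_series (\<alpha>, \<beta>)) = monom_series (\<alpha>(i := \<alpha> i + k), \<beta>)" for i k \<alpha>
    by (induction k) (simp_all add: ser.wact_mult ser_x_monom fun_upd_def cong: if_cong)
  have "distinct L \<Longrightarrow> ser.wact (prod_list (map (\<lambda>i. wx i ^ \<gamma> i) L)) (monom_series (\<alpha>, \<beta>))
      = monom_series (\<lambda>i. \<alpha> i + (if i \<in> set L then \<gamma> i else 0), \<beta>)" for L
    by (induction L) (auto simp: ser.wact_mult pow fun_upd_def intro!: arg_cong[of _ _ monom_series])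
  from this[OF enum_distinct] show ?thesis by (simp add: cmon_def UNIV_enum[symmetric])
qed

lemma cmon_wd_monom:
  "ser.wact (cmon wd \<gamma>) (monom_series (\<lambda>_. 0, \<beta>)) = monom_series (\<lambda>_. 0, \<lambda>i. \<beta> i + \<gamma> i)"
proof -
  have pow: "ser.wact (wd i ^ k) (monom_series (\<lambda>_. 0, \<beta>)) = monom_series (\<lambda>_. 0, \<beta>(i := \<beta> i + k))" for i k \<beta>
    by (induction k) (simp_all add: ser.wact_mult ser_d_monom fun_upd_def cong: if_cong)
  have "distinct L \<Longrightarrow> ser.wact (prod_list (map (\<lambda>i. wd i ^ \<gamma> i) L)) (monom_series (\<lambda>_. 0, \<beta>))
      = monom_series (\<lambda>_. 0, \<lambda>i. \<beta> i + (if i \<in> set L then \<gamma> i else 0))" for L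
    by (induction L) (auto simp: ser.wact_mult pow fun_upd_def intro!: arg_cong[of _ _ monom_series])
  from this[OF enum_distinct] show ?thesis by (simp add: cmon_def UNIV_enum[symmetric])
qed

text \<open>The coefficients of the series obtained by letting \<open>g\<close> act on the series
  \<open>1\<close>. As basis monomials become distinct monomials in \<open>x\<close> and
  \<open>y\<close>, these are the coefficients of \<open>g\<close> in the monomial basis.\<close>

definition coeff :: "('k::field, 'n) weyl \<Rightarrow> ('k, 'n) series" where
  "coeff g = ser.wact g (monom_series (\<lambda>_. 0, \<lambda>_. 0))"

lemma coeff_simps:
  "coeff (a + b) m = coeff a m + coeff b m" "coeff (a - b) m = coeff a m - coeff b m"
  "coeff (c \<cdot> a) m = c * coeff a m" "coeff 0 m = 0"
  by (simp_all add: coeff_def ser.wact_add ser.wact_diff ser.wact_scale ser_scale_def)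

lemma coeff_wmonom: "coeff (wmonom m) = monom_series m"
  by (cases m) (simp add: coeff_def wmonom_eq_cmon ser.wact_mult cmon_wd_monom cmon_wx_monom)

lemma coeff_sum:
  "finite T \<Longrightarrow> coeff (\<Sum>m\<in>T. c m \<cdot> wmonom m) m' = (if m' \<in> T then c m' else 0)"
  by (induction T rule: finite_induct) (auto simp: coeff_simps coeff_wmonom monom_series_def)

text \<open>The normal-ordering rule: moving a derivation to the right past a polynomial in the
  \<open>x\<close> leaves another polynomial in the \<open>x\<close>.\<close>

lemma commutator_cmon_wx:
  "wd i * cmon wx \<alpha> - cmon wx \<alpha> * wd i \<in> weyl_vs.span (range (cmon wx))"
proof -
  let ?S = "weyl_vs.span (range (cmon wx)) :: ('a, 'b) weyl set"
  \<comment> \<open>The polynomials for which the claim holds; by the Leibniz rule this set is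
    closed under left multiplication by each \<open>wx j\<close>.\<close>
  define T where "T = {a \<in> ?S. wd i * a - a * wd i \<in> ?S}"
  have x: "wx j * a \<in> ?S" if "a \<in> ?S" for a j
    using that
  proof (induction rule: weyl_vs.span_induct_alt)
    case (step c a b)
    then obtain \<gamma> where "a = cmon wx \<gamma>" by auto
    then have "wx j * a \<in> range (cmon wx)"
      by (simp add: mult_cmon[where y = wx, OF wx_wx])
    with step show ?case
      by (simp add: distrib_left wscale_mult_right weyl_vs.span_add weyl_vs.span_scale weyl_vs.span_base)
  qed (simp add: weyl_vs.span_zero)
  have T: "wx j * a \<in> T" if "a \<in> T" for a j
  proof -
    have "wx j * (wd i * a - a * wd i) + (if i = j then a else 0) \<in> ?S"
      using that by (intro weyl_vs.span_add x) (auto simp: T_def weyl_vs.span_zero)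
    moreover have "wd i * (wx j * a) = wx j * (wd i * a) + (if i = j then a else 0)"
      by (simp add: wd_wx distrib_right flip: mult.assoc)
    ultimately have "wd i * (wx j * a) - wx j * a * wd i \<in> ?S"
      by (simp add: right_diff_distrib mult.assoc add_diff_eq diff_add_eq)
    with x[of a j] that show ?thesis by (simp add: T_def)
  qed
  have pow: "wx j ^ k * a \<in> T" if "a \<in> T" for a j k
    using that by (induction k) (simp_all add: T mult.assoc)
  have "1 \<in> ?S"
    using weyl_vs.span_base[OF rangeI[of "cmon wx" "\<lambda>_. 0"]] by simp
  then have "1 \<in> T" by (simp add: T_def weyl_vs.span_zero)
  then have "prod_list (map (\<lambda>i. wx i ^ \<alpha> i) L) \<in> T" for L
    by (induction L) (simp_all add: pow)
  then show ?thesis by (simp add: T_def cmon_def)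
qed

text \<open>The span contains \<open>1\<close> and is stable under left multiplication by
  generators; reordering is needed only when a derivation meets the \<open>x\<close> part.\<close>

lemma span_wmonom: "g \<in> weyl_vs.span (range wmonom)"
proof -
  let ?S = "weyl_vs.span (range wmonom) :: ('a, 'b) weyl set"
  have base: "cmon wx \<alpha> * cmon wd \<beta> \<in> ?S" for \<alpha> \<beta>
    by (rule weyl_vs.span_base) (simp flip: wmonom_eq_cmon)
  have left: "a * cmon wd \<beta> \<in> ?S" if "a \<in> weyl_vs.span (range (cmon wx))" for a \<beta>
    using that
    by (induction rule: weyl_vs.span_induct_alt)
      (auto simp: weyl_vs.span_zero distrib_right wscale_mult_left weyl_vs.span_add
        weyl_vs.span_scale base)
  have x: "wx i * wmonom m \<in> ?S" for i m
  proof (cases m)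
    case (Pair \<alpha> \<beta>)
    have "wx i * cmon wx \<alpha> = (cmon wx (\<lambda>j. (if j = i then 1 else 0) + \<alpha> j) :: ('a, 'b) weyl)"
      by (rule mult_cmon[where y = wx, OF wx_wx])
    then show ?thesis using base by (simp add: Pair wmonom_eq_cmon flip: mult.assoc)
  qed
  have d: "wd i * wmonom m \<in> ?S" for i m
  proof (cases m)
    case (Pair \<alpha> \<beta>)
    have d: "wd i * cmon wd \<beta> = (cmon wd (\<lambda>j. (if j = i then 1 else 0) + \<beta> j) :: ('a, 'b) weyl)"
      by (rule mult_cmon[where y = wd, OF wd_wd])
    have "wd i * wmonom m = ((wd i * cmon wx \<alpha> - cmon wx \<alpha> * wd i) * cmon wd \<beta> :: ('a, 'b) weyl)
        + cmon wx \<alpha> * (wd i * cmon wd \<beta>)"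
      by (simp add: Pair wmonom_eq_cmon left_diff_distrib mult.assoc)
    then show ?thesis
      by (simp add: d weyl_vs.span_add left commutator_cmon_wx base)
  qed
  have mult: "z * a \<in> ?S" if "\<And>m. z * wmonom m \<in> ?S" "a \<in> ?S" for z a
    using that(2)
    by (induction rule: weyl_vs.span_induct_alt)
      (auto simp: weyl_vs.span_zero distrib_left wscale_mult_right weyl_vs.span_add
        weyl_vs.span_scale that(1))
  show ?thesis
  proof (induction g rule: weyl_induct)
    case one
    show ?case using base[of "\<lambda>_. 0" "\<lambda>_. 0"] by simp
  qed (simp_all add: weyl_vs.span_add weyl_vs.span_scale mult x d)
qed

lemma
  fixes g :: "('k::field, 'n::enum) weyl"
  shows finite_coeff: "finite {m. coeff g m \<noteq> 0}"
  and coeff_expand: "g = (\<Sum>m | coeff g m \<noteq> 0. coeff g m \<cdot> wmonom m)"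
proof -
  obtain t r where t: "finite t" "t \<subseteq> range wmonom" and g: "g = (\<Sum>v\<in>t. r v \<cdot> v)"
    using span_wmonom[of g] unfolding weyl_vs.span_explicit by auto
  \<comment> \<open>One preimage is chosen for each spanning vector, so that the sum can be indexed
    by exponents.\<close>
  obtain T where T: "inj_on (wmonom :: _ \<Rightarrow> ('k, 'n) weyl) T" "t = wmonom ` T"
    using subset_image_inj[THEN iffD1, OF t(2)] by blast
  have "finite T" using t(1) T by (simp add: finite_image_iff)
  define c where "c m = r (wmonom m)" for m
  have g': "g = (\<Sum>m\<in>T. c m \<cdot> wmonom m)"
    unfolding g T(2) c_def by (simp add: sum.reindex[OF T(1)])
  have c: "coeff g m = (if m \<in> T then c m else 0)" for m
    unfolding g' by (rule coeff_sum) fact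
  have sub: "{m. coeff g m \<noteq> 0} \<subseteq> T"
    by (auto simp: c split: if_splits)
  then show "finite {m. coeff g m \<noteq> 0}"
    using \<open>finite T\<close> by (rule finite_subset)
  have "(\<Sum>m\<in>T. c m \<cdot> wmonom m) = (\<Sum>m | coeff g m \<noteq> 0. coeff g m \<cdot> wmonom m)"
    using \<open>finite T\<close> sub by (rule sum.mono_neutral_cong_right) (auto simp: c)
  with g' show "g = (\<Sum>m | coeff g m \<noteq> 0. coeff g m \<cdot> wmonom m)" by (rule trans)
qed

lemma coeff_eq_zero:
  fixes g :: "('k::field, 'n::enum) weyl"
  assumes "\<And>m. coeff g m = 0"
  shows "g = 0"
  using coeff_expand[of g] by (simp add: assms)

lemma lookup_expansion: "Poly_Mapping.lookup (expansion g) = coeff g"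
proof -
  let ?c = "Abs_poly_mapping (coeff g)"
  have l: "Poly_Mapping.lookup ?c = coeff g"
    using finite_coeff by (rule Abs_poly_mapping_inverse[OF CollectI])
  then have k: "Poly_Mapping.keys ?c = {m. coeff g m \<noteq> 0}"
    by (simp add: keys.rep_eq)
  have "expansion g = ?c"
    unfolding expansion_def
  proof (rule the_equality)
    show "g = (\<Sum>m\<in>Poly_Mapping.keys ?c. Poly_Mapping.lookup ?c m \<cdot> wmonom m)"
      unfolding l k by (rule coeff_expand)
    fix c assume "g = (\<Sum>m\<in>Poly_Mapping.keys c. Poly_Mapping.lookup c m \<cdot> wmonom m)"
    then have "coeff g m = Poly_Mapping.lookup c m" for m
      by (auto simp: coeff_sum in_keys_iff)
    then show "c = ?c" by (intro poly_mapping_eqI) (simp add: l)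
  qed
  with l show ?thesis by simp
qed

lemma supp_eq: "supp g = {m. coeff g m \<noteq> 0}"
  by (simp add: supp_def keys.rep_eq lookup_expansion)

text \<open>Multiplying by \<open>x\<close> on the left and by derivations on the right needs no
  reordering, so basis monomials go to single basis monomials. Under the condition the subtractions
  are exact.\<close>

lemma coeff_shift:
  "coeff (cmon wx \<gamma> * g * cmon wd \<delta>) m =
    (if \<exists>m'. m = monom_plus m' (\<gamma>, \<delta>) then coeff g (\<lambda>i. fst m i - \<gamma> i, \<lambda>i. snd m i - \<delta> i) else 0)"
proof -
  let ?A = "{m. coeff g m \<noteq> 0}" and ?s = "\<lambda>m. monom_plus m (\<gamma>, \<delta>)"
  have inj: "inj ?s" by (auto simp: inj_def monom_plus_def fun_eq_iff prod_eq_iff)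
  have w: "cmon wx \<gamma> * wmonom m * cmon wd \<delta> = wmonom (?s m)" for m
  proof (cases m)
    case (Pair \<alpha> \<beta>)
    have "cmon wx \<gamma> * wmonom m * cmon wd \<delta> = (cmon wx \<gamma> * cmon wx \<alpha>) * (cmon wd \<beta> * cmon wd \<delta>)"
      by (simp add: Pair wmonom_eq_cmon mult.assoc)
    then show ?thesis
      by (simp add: cmon_mult[where y = wx, OF wx_wx] cmon_mult[where y = wd, OF wd_wd] Pair monom_plus_def
          add.commute flip: wmonom_eq_cmon)
  qed
  have "cmon wx \<gamma> * g * cmon wd \<delta> = (\<Sum>m\<in>?A. coeff g m \<cdot> wmonom (?s m))"
    by (subst coeff_expand)
      (simp add: sum_distrib_left sum_distrib_right wscale_mult_left wscale_mult_right w)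
  also have "\<dots> = (\<Sum>m\<in>?s ` ?A. coeff g (inv ?s m) \<cdot> wmonom m)"
    by (simp add: sum.reindex inj_on_subset[OF inj] inv_f_f[OF inj])
  finally have "coeff (cmon wx \<gamma> * g * cmon wd \<delta>) m
      = (if m \<in> ?s ` ?A then coeff g (inv ?s m) else 0)"
    by (simp add: coeff_sum finite_coeff)
  also have "\<dots> = (if m \<in> range ?s then coeff g (inv ?s m) else 0)"
    by (auto simp: inv_f_f[OF inj])
  finally show ?thesis
    by (auto simp: inv_f_f[OF inj]) (simp add: monom_plus_def)
qed

section \<open>Leading monomials\<close>

lemma term_orderD:
  assumes "term_order lt"
  shows "\<not> lt m m" "lt m m' \<Longrightarrow> lt m' m'' \<Longrightarrow> lt m m''" "m \<noteq> m' \<Longrightarrow> lt m m' \<or> lt m' m"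
    "lt m m' \<Longrightarrow> lt (monom_plus m c) (monom_plus m' c)"
    "m \<noteq> (\<lambda>_. 0, \<lambda>_. 0) \<Longrightarrow> lt (\<lambda>_. 0, \<lambda>_. 0) m"
proof -
  note lt = assms[unfolded term_order_def]
  show "\<not> lt m m" using lt by (blast dest: irreflpD)
  show "lt m m' \<Longrightarrow> lt m' m'' \<Longrightarrow> lt m m''" using lt by (blast dest: transpD)
  show "m \<noteq> m' \<Longrightarrow> lt m m' \<or> lt m' m" using lt by (blast dest: totalpD)
  show "lt m m' \<Longrightarrow> lt (monom_plus m c) (monom_plus m' c)"
    "m \<noteq> (\<lambda>_. 0, \<lambda>_. 0) \<Longrightarrow> lt (\<lambda>_. 0, \<lambda>_. 0) m"
    using lt by blast+
qed

lemma finite_has_lt_maximum: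
  assumes lt: "term_order lt" and "finite S" "S \<noteq> {}"
  shows "\<exists>m\<in>S. \<forall>m'\<in>S. m' \<noteq> m \<longrightarrow> lt m' m"
  using assms(2,3)
proof (induction rule: finite_ne_induct)
  case (insert x S)
  then obtain m where m: "m \<in> S" "\<forall>m'\<in>S. m' \<noteq> m \<longrightarrow> lt m' m" by auto
  show ?case
  proof (cases "lt x m")
    case True
    with m show ?thesis by auto
  next
    case False
    with m insert.hyps have "lt m x" using term_orderD(3)[OF lt, of m x] by auto
    then have "lt m' x" if "m' \<in> S" for m'
      using m that term_orderD(2)[OF lt, of m' m x] by (cases "m' = m") auto
    then show ?thesis by auto
  qed
qed simp

lemma lm_eqI:
  assumes lt: "term_order lt" and m: "coeff g m \<noteq> 0"
    and max: "\<And>m'. coeff g m' \<noteq> 0 \<Longrightarrow> m' \<noteq> m \<Longrightarrow> lt m' m"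
  shows "lm lt g = m"
  unfolding lm_def supp_eq
proof (rule the_equality)
  show "m \<in> {m. coeff g m \<noteq> 0} \<and> (\<forall>m'\<in>{m. coeff g m \<noteq> 0}. m' \<noteq> m \<longrightarrow> lt m' m)"
    using m max by auto
  fix m1 assume m1: "m1 \<in> {m. coeff g m \<noteq> 0} \<and> (\<forall>m'\<in>{m. coeff g m \<noteq> 0}. m' \<noteq> m1 \<longrightarrow> lt m' m1)"
  show "m1 = m"
  proof (rule ccontr)
    assume "m1 \<noteq> m"
    then have "m \<noteq> m1" by simp
    with m m1 have "lt m m1" by blast
    moreover have "lt m1 m" using m1 \<open>m1 \<noteq> m\<close> by (intro max) auto
    ultimately have "lt m m" by (rule term_orderD(2)[OF lt])
    then show False using term_orderD(1)[OF lt] by blast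
  qed
qed

lemma
  assumes lt: "term_order lt" and "g \<noteq> 0"
  shows coeff_lm: "coeff g (lm lt g) \<noteq> 0"
    and lm_max: "coeff g m \<noteq> 0 \<Longrightarrow> m \<noteq> lm lt g \<Longrightarrow> lt m (lm lt g)"
proof -
  have "{m. coeff g m \<noteq> 0} \<noteq> {}" using coeff_eq_zero[of g] assms(2) by auto
  from finite_has_lt_maximum[OF lt finite_coeff this]
  obtain m1 where m1: "coeff g m1 \<noteq> 0" "\<And>m'. coeff g m' \<noteq> 0 \<Longrightarrow> m' \<noteq> m1 \<Longrightarrow> lt m' m1" by auto
  from lm_eqI[OF lt this] have "lm lt g = m1" .
  with m1 show "coeff g (lm lt g) \<noteq> 0"
    and "coeff g m \<noteq> 0 \<Longrightarrow> m \<noteq> lm lt g \<Longrightarrow> lt m (lm lt g)" by auto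
qed

section \<open>Surjective endomorphisms are injective\<close>

lemma nat_incseq_subseq:
  fixes u :: "nat \<Rightarrow> nat"
  obtains q where "strict_mono q" "incseq (\<lambda>n. u (q n))"
proof -
  obtain r where r: "strict_mono r" "monoseq (\<lambda>n. u (r n))"
    using seq_monosub by blast
  show ?thesis
  proof (cases "incseq (\<lambda>n. u (r n))")
    case True
    with r(1) show ?thesis by (rule that)
  next
    case False
    with r(2) have dec: "decseq (\<lambda>n. u (r n))" by (auto simp: monoseq_iff)
    \<comment> \<open>A decreasing sequence of natural numbers is constant from the index of its
      minimum on.\<close>
    obtain N where N: "\<And>n. u (r N) \<le> u (r n)"
      using ex_has_least_nat[of "\<lambda>_. True" _ "\<lambda>n. u (r n)"] by auto
    have "u (r (n + N)) = u (r N)" for n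
      using N[of "n + N"] decseqD[OF dec, of N "n + N"] by simp
    then show ?thesis
      using r(1) by (intro that[of "\<lambda>n. r (n + N)"]) (auto simp: strict_mono_def incseq_def)
  qed
qed

text \<open>Passing to a subsequence for one exponent after another makes all of them increasing at
  once; then any two terms, here the first two, are comparable.\<close>

lemma dickson:
  fixes s :: "nat \<Rightarrow> 'n::finite monomial"
  obtains i j where "i < j" "monom_dvd (s i) (s j)"
proof -
  define u where "u k c = (case c of Inl i \<Rightarrow> fst (s k) i | Inr i \<Rightarrow> snd (s k) i)" for k c
  have "\<exists>r. strict_mono r \<and> (\<forall>c\<in>C. incseq (\<lambda>n. u (r n) c))" if "finite C" for C
    using that
  proof (induction C rule: finite_induct)
    case empty
    have "strict_mono (\<lambda>n::nat. n)" by (simp add: strict_mono_def)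
    then show ?case by blast
  next
    case (insert c C)
    then obtain r where r: "strict_mono r" "\<forall>c\<in>C. incseq (\<lambda>n. u (r n) c)" by blast
    obtain q where q: "strict_mono q" "incseq (\<lambda>n. u (r (q n)) c)"
      using nat_incseq_subseq[of "\<lambda>n. u (r n) c"] by blast
    have "strict_mono (\<lambda>n. r (q n))" using r(1) q(1) by (simp add: strict_mono_def)
    moreover have "incseq (\<lambda>n. u (r (q n)) c')" if "c' \<in> C" for c'
      using r(2) that q(1) by (auto simp: incseq_def strict_mono_less_eq)
    ultimately show ?case using q(2) by (intro exI[of _ "\<lambda>n. r (q n)"]) auto
  qed
  from this[of UNIV] obtain r where r: "strict_mono r" "\<And>c. incseq (\<lambda>n. u (r n) c)" by auto
  have "u (r 0) c \<le> u (r 1) c" for c using r(2)[of c] by (simp add: incseq_def)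
  from this[of "Inl _"] this[of "Inr _"] have "monom_dvd (s (r 0)) (s (r 1))"
    by (simp add: monom_dvd_def u_def)
  moreover have "r 0 < r 1" using r(1) by (simp add: strict_mono_def)
  ultimately show ?thesis using that by blast
qed

lemma wf_lex_less: "wf {(m, m'). lex_less m m'}"
proof -
  have "wf (lex {(a, b). a < (b::nat)})" by (intro wf_lex) (simp add: wf_less)
  from wf_inv_image[OF this, of exponent_list] show ?thesis
    by (simp add: inv_image_def lex_less_def)
qed

lemma ex_wf_term_order: "\<exists>lt :: 'n::enum monomial \<Rightarrow> _. term_order lt \<and> wf {(m, m'). lt m m'}"
proof -
  \<comment> \<open>Padding with zero exponents is injective and additive, so the lexicographic
    order on doubled indices pulls back to a well-founded term order.\<close>
  define ext :: "'n monomial \<Rightarrow> ('n + 'n) monomial"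
    where "ext m = (case_sum (fst m) (\<lambda>_. 0), case_sum (snd m) (\<lambda>_. 0))" for m
  define lt where "lt m m' \<longleftrightarrow> lex_less (ext m) (ext m')" for m m'
  have inj: "ext m = ext m' \<longleftrightarrow> m = m'" for m m'
  proof
    assume "ext m = ext m'"
    then have "fst (ext m) (Inl i) = fst (ext m') (Inl i)" "snd (ext m) (Inl i) = snd (ext m') (Inl i)" for i
      by simp_all
    then show "m = m'" by (simp add: ext_def prod_eq_iff fun_eq_iff)
  qed simp
  have plus: "ext (monom_plus m m') = monom_plus (ext m) (ext m')" for m m'
    by (auto simp: ext_def monom_plus_def fun_eq_iff split: sum.splits)
  have zero: "ext (\<lambda>_. 0, \<lambda>_. 0) = (\<lambda>_. 0, \<lambda>_. 0)"
    by (auto simp: ext_def fun_eq_iff split: sum.splits)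
  note lex = term_order_lex_less[where 'n = 'n]
  have "term_order lt"
    unfolding term_order_def
  proof (intro conjI allI impI)
    show "irreflp lt"
      by (simp add: irreflp_def lt_def term_orderD(1)[OF lex])
    show "totalp lt"
      unfolding totalp_on_def lt_def using term_orderD(3)[OF lex] by (simp add: inj)
    show "transp lt"
      unfolding transp_def lt_def by (intro allI impI) (rule term_orderD(2)[OF lex])
    show "lt (\<lambda>_. 0, \<lambda>_. 0) m" if "m \<noteq> (\<lambda>_. 0, \<lambda>_. 0)" for m
    proof -
      have "ext m \<noteq> ext (\<lambda>_. 0, \<lambda>_. 0)" using that by (simp add: inj)
      then show ?thesis unfolding lt_def zero by (rule term_orderD(5)[OF lex])
    qed
    show "lt (monom_plus m c) (monom_plus m' c)" if "lt m m'" for m m' c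
      using that term_orderD(4)[OF lex] by (simp add: lt_def plus)
  qed
  moreover have "wf {(m, m'). lt m m'}"
    using wf_inv_image[OF wf_lex_less, of ext] by (simp add: inv_image_def lt_def)
  ultimately show ?thesis by blast
qed

lemma algebra_hom_funpow:
  fixes f :: "('k::field, 'n) weyl \<Rightarrow> ('k, 'n) weyl"
  assumes "algebra_hom f"
  shows "algebra_hom (f ^^ k)"
  by (induction k) (use assms in \<open>auto simp: algebra_hom_def\<close>)

text \<open>
  The kernels of the powers of a surjective, non-injective endomorphism would form a strictly
  increasing sequence of two-sided ideals.  Two-sided ideals are stable under
  \<open>g \<mapsto> x\<^sup>\<gamma> g \<partial>\<^sup>\<delta>\<close>, which maps the basis element \<open>x\<^sup>\<alpha> \<partial>\<^sup>\<beta>\<close> to \<open>x\<^sup>\<alpha>\<^sup>+\<^sup>\<gamma> \<partial>\<^sup>\<beta>\<^sup>+\<^sup>\<delta>\<close>; so the proof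
  of Hilbert's basis theorem by Dickson's lemma applies as in a commutative polynomial ring.
\<close>

lemma surj_endo_imp_inj:
  fixes f :: "('k::field, 'n::enum) weyl \<Rightarrow> ('k, 'n) weyl"
  assumes f: "algebra_hom f" and "surj f"
  shows "inj f"
proof (rule ccontr)
  assume "\<not> inj f"
  then obtain a b where ab: "f a = f b" "a \<noteq> b" by (auto simp: inj_def)
  define \<nu> where "\<nu> = a - b"
  have \<nu>: "f \<nu> = 0" "\<nu> \<noteq> 0" using ab by (simp_all add: \<nu>_def algebra_hom_simps[OF f])
  obtain lt :: "'n monomial \<Rightarrow> _" where lt: "term_order lt" and wf: "wf {(m, m'). lt m m'}"
    using ex_wf_term_order by blast
  note pow = algebra_hom_simps[OF algebra_hom_funpow[OF f]]
  \<comment> \<open>The elements that are new in the kernel of the \<open>j + 1\<close>st power. A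
    preimage of \<open>\<nu>\<close> under the \<open>j\<close>th power is one, and well-foundedness
    provides one with minimal leading monomial.\<close>
  define D where "D j = {a. (f ^^ Suc j) a = 0 \<and> (f ^^ j) a \<noteq> 0}" for j
  have "\<exists>g. g \<in> D j \<and> (\<forall>h\<in>D j. \<not> lt (lm lt h) (lm lt g))" for j
  proof -
    have "surj (f ^^ j)" using \<open>surj f\<close> by (rule surj_fn)
    then obtain a where "\<nu> = (f ^^ j) a" by (rule surjE)
    then have "a \<in> D j" using \<nu> by (simp add: D_def)
    then show ?thesis
    proof (rule wfE_min[OF wf_inv_image[OF wf, of "lm lt"]])
      fix g assume "g \<in> D j" "\<And>h. (h, g) \<in> inv_image {(m, m'). lt m m'} (lm lt) \<Longrightarrow> h \<notin> D j"
      then show ?thesis by (intro exI[of _ g]) auto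
    qed
  qed
  then have "\<exists>g. \<forall>j. g j \<in> D j \<and> (\<forall>h\<in>D j. \<not> lt (lm lt h) (lm lt (g j)))"
    by (intro choice allI)
  then obtain g where g: "\<And>j. g j \<in> D j" and min: "\<And>j h. h \<in> D j \<Longrightarrow> \<not> lt (lm lt h) (lm lt (g j))"
    by blast
  obtain i j where ij: "i < j" and dvd: "monom_dvd (lm lt (g i)) (lm lt (g j))"
    by (rule dickson)
  have nz: "g k \<noteq> 0" for k using g[of k] pow(5)[of k] by (auto simp: D_def)
  define M where "M = lm lt (g j)"
  define \<gamma> \<delta> where "\<gamma> = (\<lambda>k. fst M k - fst (lm lt (g i)) k)"
    and "\<delta> = (\<lambda>k. snd M k - snd (lm lt (g i)) k)"
  have M: "M = monom_plus (lm lt (g i)) (\<gamma>, \<delta>)"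
    using dvd by (auto simp: monom_plus_def M_def \<gamma>_def \<delta>_def monom_dvd_def prod_eq_iff fun_eq_iff)
  define s where "s = cmon wx \<gamma> * g i * cmon wd \<delta>"
  have coeff_s: "coeff s (monom_plus m (\<gamma>, \<delta>)) = coeff (g i) m" for m
    by (auto simp: s_def coeff_shift monom_plus_def)
  have coeff_s_nz: "\<exists>m'. m = monom_plus m' (\<gamma>, \<delta>)" if "coeff s m \<noteq> 0" for m
    using that by (auto simp: s_def coeff_shift split: if_splits)
  \<comment> \<open>Chosen so that the leading terms of \<open>g j\<close> and
    \<open>c \<cdot> s\<close> cancel.\<close>
  define c where "c = coeff (g j) M / coeff (g i) (lm lt (g i))"
  define h where "h = g j - c \<cdot> s"
  have coeff_h_M: "coeff h M = 0"
    using coeff_lm[OF lt nz[of i]] unfolding M by (simp add: h_def coeff_simps coeff_s c_def M)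
  \<comment> \<open>As \<open>i < j\<close>, the \<open>j\<close>th power kills \<open>g i\<close>
    and hence \<open>s\<close>. So \<open>h\<close> stays in \<open>D j\<close>, although its
    leading monomial drops, against minimality.\<close>
  have "(f ^^ j) (g i) = 0"
  proof -
    have "j = (j - Suc i) + Suc i" using ij by simp
    then have "(f ^^ j) (g i) = (f ^^ (j - Suc i)) ((f ^^ Suc i) (g i))"
      by (metis comp_apply funpow_add)
    then show ?thesis using g[of i] by (simp only: D_def mem_Collect_eq pow(5))
  qed
  then have "(f ^^ j) h = (f ^^ j) (g j)"
    by (simp add: h_def s_def pow)
  then have h: "h \<in> D j" using g[of j] by (simp add: D_def)
  then have "h \<noteq> 0" using pow(5)[of j] by (auto simp: D_def)
  define m where "m = lm lt h"
  have "coeff h m \<noteq> 0" unfolding m_def by (rule coeff_lm[OF lt \<open>h \<noteq> 0\<close>])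
  then have mM: "m \<noteq> M" using coeff_h_M by auto
  have "lt m M"
  proof (cases "coeff (g j) m = 0")
    case False
    then show ?thesis using lm_max[OF lt nz] mM by (simp add: M_def)
  next
    case True
    with \<open>coeff h m \<noteq> 0\<close> have "coeff s m \<noteq> 0" by (auto simp: h_def coeff_simps)
    moreover from coeff_s_nz[OF this] obtain m' where m': "m = monom_plus m' (\<gamma>, \<delta>)" by auto
    ultimately have "coeff (g i) m' \<noteq> 0" by (simp add: coeff_s)
    moreover have "m' \<noteq> lm lt (g i)" using mM by (auto simp: m' M)
    ultimately have "lt m' (lm lt (g i))" by (rule lm_max[OF lt nz])
    then show ?thesis unfolding m' M by (rule term_orderD(4)[OF lt])
  qed
  then show False using min[OF h] by (simp add: m_def M_def)
qed

section \<open>The lexicographic Groebner basis\<close>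

definition second_copy_monom :: "('n + 'n) monomial \<Rightarrow> bool" where
  "second_copy_monom m \<longleftrightarrow> (\<forall>i. fst m (Inl i) = 0 \<and> snd m (Inl i) = 0)"

text \<open>Generators of the second copy change only exponents with index \<open>Inr\<close>, so
  series supported on monomials of the second copy stay so.\<close>

lemma coeff_second_copy:
  assumes "g \<in> second_copy" "coeff g m \<noteq> 0"
  shows "second_copy_monom m"
proof -
  obtain a where a: "g = embed Inr a" using assms(1) by (auto simp: second_copy_eq_range)
  have "second_copy_monom m" if "ser.wact (embed Inr a) F m \<noteq> 0"
    "\<And>m. F m \<noteq> 0 \<Longrightarrow> second_copy_monom m" for F :: "('a, 'b + 'b) series" and m
    using that
  proof (induction a arbitrary: m rule: weyl_induct)
    case (add a b)
    have "ser.wact (embed Inr a) F m \<noteq> 0 \<or> ser.wact (embed Inr b) F m \<noteq> 0"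
      using add.prems(1) by (auto simp: embed_simps ser.wact_add)
    with add.IH add.prems(2) show ?case by blast
  next
    case (wx i a)
    obtain \<alpha> \<beta> where m: "m = (\<alpha>, \<beta>)" by fastforce
    have "ser.wact (embed Inr a) F (\<alpha>(Inr i := \<alpha> (Inr i) - 1), \<beta>) \<noteq> 0"
      using wx.prems(1) by (simp add: m embed_simps ser.wact_mult ser_x_apply split: if_splits)
    from wx.IH[OF this wx.prems(2)] show ?case by (simp add: m second_copy_monom_def)
  next
    case (wd i a)
    obtain \<alpha> \<beta> where m: "m = (\<alpha>, \<beta>)" by fastforce
    let ?m1 = "(\<alpha>, \<beta>(Inr i := \<beta> (Inr i) - 1))" and ?m2 = "(\<alpha>(Inr i := Suc (\<alpha> (Inr i))), \<beta>)"
    have "ser.wact (embed Inr a) F ?m1 \<noteq> 0 \<or> ser.wact (embed Inr a) F ?m2 \<noteq> 0"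
      using wd.prems(1) by (auto simp: m embed_simps ser.wact_mult ser_d_apply split: if_splits)
    with wd.IH wd.prems(2) have "second_copy_monom ?m1 \<or> second_copy_monom ?m2" by blast
    then show ?case by (auto simp: m second_copy_monom_def)
  qed (auto simp: embed_simps ser.wact_scale ser_scale_def)
  moreover have "monom_series (\<lambda>_. 0, \<lambda>_. 0) m \<noteq> (0 :: 'a) \<Longrightarrow> second_copy_monom m"
    for m :: "('b + 'b) monomial"
    by (auto simp: monom_series_def second_copy_monom_def split: if_splits)
  ultimately show ?thesis using assms(2) unfolding a coeff_def by blast
qed

lemma in_second_copyI:
  fixes g :: "('k::field, 'n::enum + 'n) weyl"
  assumes "\<And>m. coeff g m \<noteq> 0 \<Longrightarrow> second_copy_monom m"
  shows "g \<in> second_copy"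
proof -
  let ?B = "second_copy :: ('k, 'n + 'n) weyl set"
  have S: "subalgebra ?B" unfolding second_copy_def by (rule subalgebra_hull)
  have one: "1 \<in> ?B" and add: "\<And>a b. a \<in> ?B \<Longrightarrow> b \<in> ?B \<Longrightarrow> a + b \<in> ?B"
    and mult: "\<And>a b. a \<in> ?B \<Longrightarrow> b \<in> ?B \<Longrightarrow> a * b \<in> ?B"
    and scale: "\<And>c a. a \<in> ?B \<Longrightarrow> c \<cdot> a \<in> ?B"
    using S by (simp_all add: subalgebra_def)
  have gen: "wx (Inr i) \<in> ?B" "wd (Inr i) \<in> ?B" for i
    unfolding second_copy_def by (auto intro: hull_inc)
  have pow: "a ^ k \<in> ?B" if "a \<in> ?B" for a k
    using that by (induction k) (simp_all add: one mult)
  have "cmon y \<alpha> \<in> ?B" if "\<And>i. y (Inr i) \<in> ?B" "\<And>i. \<alpha> (Inl i) = 0"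
    for y :: "'n + 'n \<Rightarrow> ('k, 'n + 'n) weyl" and \<alpha>
  proof -
    have "y j ^ \<alpha> j \<in> ?B" for j
      using that by (cases j) (simp_all add: one pow)
    then have "prod_list (map (\<lambda>i. y i ^ \<alpha> i) L) \<in> ?B" for L
      by (induction L) (simp_all add: one mult)
    then show ?thesis by (simp add: cmon_def)
  qed
  then have monom: "wmonom m \<in> ?B" if "second_copy_monom m" for m
    using that gen by (cases m) (simp add: wmonom_eq_cmon mult second_copy_monom_def)
  have "0 \<in> ?B" using scale[OF one, of 0] by simp
  then have sum: "(\<Sum>m\<in>A. h m) \<in> ?B" if "\<And>m. m \<in> A \<Longrightarrow> h m \<in> ?B" for A and h :: "('n + 'n) monomial \<Rightarrow> _"
    using that by (induction A rule: infinite_finite_induct) (simp_all add: add)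
  show ?thesis
    by (subst coeff_expand) (intro sum scale monom assms, simp)
qed

lemma lex_append_same_length:
  "(us, us') \<in> lex r \<Longrightarrow> (us @ vs, us' @ vs') \<in> lex r" if "length vs = length vs'"
proof (induction us arbitrary: us')
  case (Cons u us)
  then show ?case using that by (cases us') (auto simp: Cons_in_lex)
qed simp

text \<open>The elimination property of the order: exponents of the first copy come first in the
  list, and a zero initial segment is lexicographically smaller than a non-zero one.\<close>

lemma lex_less_if_second_copy_monom:
  fixes m m' :: "('n::enum + 'n) monomial"
  assumes "second_copy_monom m" "\<not> second_copy_monom m'"
  shows "lex_less m m'"
proof -
  let ?h = "\<lambda>m :: ('n + 'n) monomial. map (\<lambda>i. fst m (Inl i)) enum_class.enum @ map (\<lambda>i. snd m (Inl i)) enum_class.enum"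
  have m: "?h m = replicate (length (?h m')) 0"
    using assms(1) by (intro replicate_eqI) (auto simp: second_copy_monom_def)
  have "?h m' \<noteq> replicate (length (?h m')) 0"
  proof
    assume "?h m' = replicate (length (?h m')) 0"
    then have "\<forall>x\<in>set (?h m'). x = 0" by (metis in_set_replicate)
    with assms(2) show False by (auto simp: second_copy_monom_def enum_UNIV)
  qed
  from lex_zero[OF refl this] have "(?h m, ?h m') \<in> lex {(a, b). a < b}"
    unfolding m .
  from lex_append_same_length[OF _ this] show ?thesis
    by (simp add: lex_less_def exponent_list_def)
qed

text \<open>Here \<^term>\<open>Inl i\<close> encodes \<open>x\<^sub>i\<close> and \<^term>\<open>Inr i\<close> encodes \<open>\<partial>\<^sub>i\<close>, both in the first copy of \<open>A\<close>.\<close>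

definition first_var :: "'n + 'n \<Rightarrow> ('n + 'n) monomial" where
  "first_var v = (case v of Inl i \<Rightarrow> (\<lambda>j. if j = Inl i then 1 else 0, \<lambda>_. 0)
     | Inr i \<Rightarrow> (\<lambda>_. 0, \<lambda>j. if j = Inl i then 1 else 0))"

lemma wmonom_first_var:
  "wmonom (first_var (Inl i)) = wx (Inl i)" "wmonom (first_var (Inr i)) = wd (Inl i)"
  by (simp_all add: first_var_def wmonom_eq_cmon cmon_single)

lemma not_second_copy_monom_iff:
  "\<not> second_copy_monom m \<longleftrightarrow> (\<exists>v. monom_dvd (first_var v) m)"
proof
  assume "\<not> second_copy_monom m"
  then obtain i where "fst m (Inl i) \<noteq> 0 \<or> snd m (Inl i) \<noteq> 0"
    by (auto simp: second_copy_monom_def)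
  then have "monom_dvd (first_var (Inl i)) m \<or> monom_dvd (first_var (Inr i)) m"
    by (auto simp: monom_dvd_def first_var_def)
  then show "\<exists>v. monom_dvd (first_var v) m" by auto
next
  assume "\<exists>v. monom_dvd (first_var v) m"
  then obtain v where v: "monom_dvd (first_var v) m" ..
  show "\<not> second_copy_monom m"
  proof (cases v)
    case (Inl i)
    with v have "1 \<le> fst m (Inl i)"
      by (auto simp: monom_dvd_def first_var_def dest!: spec[of _ "Inl i"])
    then show ?thesis unfolding second_copy_monom_def by (metis not_one_le_zero)
  next
    case (Inr i)
    with v have "1 \<le> snd m (Inl i)"
      by (auto simp: monom_dvd_def first_var_def dest!: spec[of _ "Inl i"])
    then show ?thesis unfolding second_copy_monom_def by (metis not_one_le_zero)
  qed
qed

lemma monom_dvd_first_var: "monom_dvd (first_var v) (first_var w) \<Longrightarrow> v = w"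
  by (cases v; cases w) (auto simp: monom_dvd_def first_var_def split: if_splits)

lemma not_second_copy_monom_first_var: "\<not> second_copy_monom (first_var v)"
  unfolding not_second_copy_monom_iff by (rule exI[of _ v]) (simp add: monom_dvd_def)

text \<open>The leading monomials are the variables of the first copy. The remaining terms lie in
  the second copy, where none of these divides, and distinct variables do not divide each other;
  hence the basis is reduced.\<close>

lemma reduced_groebner_basis_first_vars:
  fixes b :: "'n::enum + 'n \<Rightarrow> ('k::field, 'n + 'n) weyl"
  assumes b: "\<And>v. b v \<in> second_copy"
    and I: "left_ideal hull (range (\<lambda>v. wmonom (first_var v) + b v)) = I"
    and triv: "\<And>g. g \<in> I \<Longrightarrow> g \<in> second_copy \<Longrightarrow> g = 0"
  shows "reduced_groebner_basis_of lex_less I (range (\<lambda>v. wmonom (first_var v) + b v))"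
proof -
  let ?u = "\<lambda>v. wmonom (first_var v) + b v"
  note lt = term_order_lex_less[where 'n = 'n]
  have coeff_b: "coeff (b v) (first_var w) = 0" for v w
    using coeff_second_copy[OF b] not_second_copy_monom_first_var by blast
  have coeff_var: "coeff (?u v) (first_var v) = 1" for v
    by (simp add: coeff_simps coeff_wmonom monom_series_def coeff_b)
  have supp: "m = first_var v \<or> second_copy_monom m" if "coeff (?u v) m \<noteq> 0" for v m
    using that coeff_second_copy[OF b, of v m]
    by (auto simp: coeff_simps coeff_wmonom monom_series_def split: if_splits)
  have lm: "lm lex_less (?u v) = first_var v" for v
  proof (rule lm_eqI[OF lt])
    show "coeff (?u v) (first_var v) \<noteq> 0" by (simp add: coeff_var)
    show "lex_less m (first_var v)" if "coeff (?u v) m \<noteq> 0" "m \<noteq> first_var v" for m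
      using supp[OF that(1)] that(2) not_second_copy_monom_first_var
      by (blast intro: lex_less_if_second_copy_monom)
  qed
  have nz: "?u v \<noteq> 0" for v
    using coeff_var[of v] by (metis coeff_simps(4) zero_neq_one)
  have "groebner_basis lex_less (range ?u)"
    unfolding groebner_basis_def I
  proof (intro conjI ballI impI)
    fix g assume "g \<in> I" "g \<noteq> 0"
    have "\<not> second_copy_monom (lm lex_less g)"
    proof
      assume lm: "second_copy_monom (lm lex_less g)"
      \<comment> \<open>By elimination, a leading monomial in the second copy forces every other
        monomial of \<open>g\<close> into it.\<close>
      have "second_copy_monom m" if "coeff g m \<noteq> 0" for m
      proof (rule ccontr)
        assume m: "\<not> second_copy_monom m"
        then have "lex_less (lm lex_less g) m" by (rule lex_less_if_second_copy_monom[OF lm])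
        moreover have "m \<noteq> lm lex_less g" using m lm by blast
        then have "lex_less m (lm lex_less g)" by (rule lm_max[OF lt \<open>g \<noteq> 0\<close> that])
        ultimately have "lex_less m m" using term_orderD(2)[OF lt] by blast
        then show False using term_orderD(1)[OF lt] by blast
      qed
      then have "g \<in> second_copy" by (rule in_second_copyI)
      with \<open>g \<in> I\<close> \<open>g \<noteq> 0\<close> show False using triv by blast
    qed
    then obtain v where "monom_dvd (first_var v) (lm lex_less g)"
      by (auto simp: not_second_copy_monom_iff)
    then show "\<exists>d\<in>range ?u - {0}. monom_dvd (lm lex_less d) (lm lex_less g)"
      using nz[of v] lm[of v] by (intro bexI[of _ "?u v"]) auto
  qed simp
  moreover have "\<not> reducible lex_less (?u v) (range ?u - {?u v})" for v
  proof
    assume "reducible lex_less (?u v) (range ?u - {?u v})"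
    then obtain m w where m: "coeff (?u v) m \<noteq> 0" and w: "?u w \<noteq> ?u v"
      and "monom_dvd (lm lex_less (?u w)) m"
      unfolding reducible_def supp_eq by blast
    then have dvd: "monom_dvd (first_var w) m" by (simp only: lm)
    have "\<not> second_copy_monom m" using dvd not_second_copy_monom_iff by blast
    with supp[OF m] dvd have "w = v" using monom_dvd_first_var by blast
    with w show False by simp
  qed
  ultimately show ?thesis
    using nz by (auto simp: reduced_groebner_basis_of_def groebner_basis_of_def I lc_def
        lookup_expansion lm coeff_var)
qed

lemma range_first_var:
  "range (\<lambda>v. wmonom (first_var v) + case_sum b c v) =
    range (\<lambda>i. wx (Inl i) + b i) \<union> range (\<lambda>i. wd (Inl i) + c i)"
  by (simp add: UNIV_sum image_Un image_image wmonom_first_var)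

lemma second_copy_minus: "a \<in> second_copy \<Longrightarrow> - a \<in> second_copy"
  by (auto simp: second_copy_eq_range simp flip: embed_simps(15))

section \<open>From generators of the ideal back to the endomorphism\<close>

context endo_antihom
begin

text \<open>Applying \<open>eps\<close> to the generators exhibits preimages under \<open>f\<close>
  of all \<open>wx i\<close> and \<open>wd i\<close>. Injectivity is a premise of the formulas for
  the inverse; \<open>surj_endo_imp_inj\<close> supplies it later.\<close>

lemma bij_if_endo_ideal_eq:
  fixes q p :: "'n \<Rightarrow> ('k, 'n + 'n) weyl"
  assumes qp: "\<And>i. q i \<in> second_copy" "\<And>i. p i \<in> second_copy"
    and J: "endo_ideal f = left_ideal hull
      (range (\<lambda>i. wx (Inl i) - q i) \<union> range (\<lambda>i. wd (Inl i) - p i))"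
  shows "surj f" and "inj f \<Longrightarrow> embed Inr (inv f (wx i)) = \<tau> (q i)"
    and "inj f \<Longrightarrow> embed Inr (inv f (wd i)) = \<tau> (p i)"
proof -
  obtain q' p' where q': "q i = embed Inr (q' i)" and p': "p i = embed Inr (p' i)" for i
    using qp unfolding second_copy_eq_range image_iff by metis
  have "wx (Inl i) - q i \<in> endo_ideal f" "wd (Inl i) - p i \<in> endo_ideal f" for i
    unfolding J by (auto intro: hull_inc)
  then have x: "f (adj (q' i)) = wx i" and d: "f (adj (p' i)) = wd i" for i
    using eps_eq_if_in_endo_ideal[of "wx (Inl i)" "q' i"]
      eps_eq_if_in_endo_ideal[of "wd (Inl i)" "p' i"] by (simp_all add: q' p' eps_gens)
  show "surj f" by (rule surj_if_gens_in_range[OF f]) (metis x d rangeI)+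
  assume "inj f"
  then show "embed Inr (inv f (wx i)) = \<tau> (q i)" "embed Inr (inv f (wd i)) = \<tau> (p i)"
    by (simp_all add: q' p' \<tau>_embed inv_f_f flip: x d)
qed

end

theorem theorem3p10:
  fixes f :: "('k::field, 'n::enum) weyl \<Rightarrow> ('k, 'n) weyl"
    and \<tau> :: "('k, 'n + 'n) weyl \<Rightarrow> ('k, 'n + 'n) weyl"
  assumes f: "algebra_hom f"
    and \<tau>: "algebra_antihom_on second_copy \<tau>"
    and \<tau>_x: "\<And>i. \<tau> (wx (Inr i)) = wx (Inr i)"
    and \<tau>_d: "\<And>i. \<tau> (wd (Inr i)) = - wd (Inr i)"
  shows
    "(invertible_endo f \<longrightarrow>
        endo_ideal f = left_ideal hull
          (range (\<lambda>i. wx (Inl i) - \<tau> (on_second_copy (inv f) (wx (Inr i)))) \<union>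
           range (\<lambda>i. wd (Inl i) - \<tau> (on_second_copy (inv f) (wd (Inr i))))))
     \<and>
     (\<forall>q p. (\<forall>i. q i \<in> second_copy \<and> p i \<in> second_copy) \<and>
        endo_ideal f = left_ideal hull
          (range (\<lambda>i. wx (Inl i) - q i) \<union> range (\<lambda>i. wd (Inl i) - p i)) \<longrightarrow>
        invertible_endo f \<and>
        (\<forall>i. on_second_copy (inv f) (wx (Inr i)) = \<tau> (q i) \<and>
             on_second_copy (inv f) (wd (Inr i)) = \<tau> (p i)))
     \<and>
     (invertible_endo f \<longleftrightarrow>
        (\<exists>q p. (\<forall>i. q i \<in> second_copy \<and> p i \<in> second_copy) \<and>
           reduced_groebner_basis_of lex_less (endo_ideal f)
             (range (\<lambda>i. wx (Inl i) - q i) \<union> range (\<lambda>i. wd (Inl i) + p i))))"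
proof -
  interpret endo_antihom f \<tau>
    using assms by unfold_locales
  note inv_iff = invertible_endo_iff[OF f]
  let ?q = "\<lambda>i. \<tau> (on_second_copy (inv f) (wx (Inr i)))"
  let ?p = "\<lambda>i. \<tau> (on_second_copy (inv f) (wd (Inr i)))"
  have i: "endo_ideal f = left_ideal hull
      (range (\<lambda>i. wx (Inl i) - ?q i) \<union> range (\<lambda>i. wd (Inl i) - ?p i))"
    if "invertible_endo f"
    using endo_ideal_eq_graph_ideal that by (simp add: inv_iff on_second_copy_gens \<tau>_embed)
  have ii: "invertible_endo f \<and>
      (\<forall>i. on_second_copy (inv f) (wx (Inr i)) = \<tau> (q i) \<and>
           on_second_copy (inv f) (wd (Inr i)) = \<tau> (p i))"
    if "\<forall>i. q i \<in> second_copy \<and> p i \<in> second_copy"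
      and "endo_ideal f = left_ideal hull
        (range (\<lambda>i. wx (Inl i) - q i) \<union> range (\<lambda>i. wd (Inl i) - p i))" for q p
  proof -
    note * = bij_if_endo_ideal_eq[of q p, OF _ _ that(2)]
    have "surj f" using *(1) that(1) by blast
    moreover from this have "inj f" by (rule surj_endo_imp_inj[OF f])
    ultimately show ?thesis
      using *(2,3) that(1) by (simp add: inv_iff bij_def on_second_copy_gens)
  qed
  have iii: "\<exists>q p. (\<forall>i. q i \<in> second_copy \<and> p i \<in> second_copy) \<and>
      reduced_groebner_basis_of lex_less (endo_ideal f)
        (range (\<lambda>i. wx (Inl i) - q i) \<union> range (\<lambda>i. wd (Inl i) + p i))"
    if inv: "invertible_endo f"
  proof -
    have B: "?q i \<in> second_copy" "?p i \<in> second_copy" for i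
      by (simp_all add: on_second_copy_gens \<tau>_embed second_copy_eq_range)
    let ?b = "case_sum (\<lambda>i. - ?q i) (\<lambda>i. - ?p i)"
    have R: "range (\<lambda>v. wmonom (first_var v) + ?b v) =
        range (\<lambda>i. wx (Inl i) - ?q i) \<union> range (\<lambda>i. wd (Inl i) + - ?p i)"
      unfolding range_first_var by simp
    have "inj f" using inv by (simp add: inv_iff bij_def)
    have "reduced_groebner_basis_of lex_less (endo_ideal f)
        (range (\<lambda>v. wmonom (first_var v) + ?b v))"
    proof (rule reduced_groebner_basis_first_vars)
      show "?b v \<in> second_copy" for v
        by (cases v) (simp_all add: B second_copy_minus)
      show "left_ideal hull range (\<lambda>v. wmonom (first_var v) + ?b v) = endo_ideal f"
        unfolding R using i[OF inv] by simp
      show "g = 0" if "g \<in> endo_ideal f" "g \<in> second_copy" for g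
        using second_copy_inter_endo_ideal[OF \<open>inj f\<close>] that by blast
    qed
    then show ?thesis unfolding R
      by (intro exI[of _ ?q] exI[of _ "\<lambda>i. - ?p i"] conjI allI) (simp_all add: B second_copy_minus)
  qed
  have iv: "invertible_endo f"
    if "\<forall>i. q i \<in> second_copy \<and> p i \<in> second_copy"
      and "reduced_groebner_basis_of lex_less (endo_ideal f)
        (range (\<lambda>i. wx (Inl i) - q i) \<union> range (\<lambda>i. wd (Inl i) + p i))" for q p
    \<comment> \<open>The basis is written with \<open>+ p i\<close>, whereas the criterion is
      stated with a difference; hence the negation.\<close>
    using that ii[of q "\<lambda>i. - p i"]
    by (simp add: reduced_groebner_basis_of_def groebner_basis_of_def second_copy_minus)
  show ?thesis
  proof (intro conjI)
    show "invertible_endo f \<longleftrightarrow> (\<exists>q p. (\<forall>i. q i \<in> second_copy \<and> p i \<in> second_copy) \<and>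
        reduced_groebner_basis_of lex_less (endo_ideal f)
          (range (\<lambda>i. wx (Inl i) - q i) \<union> range (\<lambda>i. wd (Inl i) + p i)))"
      using iii iv by (intro iffI) (assumption | elim exE conjE)+
  qed (rule impI, erule i, intro allI impI, elim conjE, rule ii, assumption+)
qed

end
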